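(* There exists a universal (absolute) constant $C_2>0$ such that the following holds. Let $q>1$ and $\epsilon\in(0,1]$, and let the hyperparameters be chosen so that $q'\in(1,2]$ with $q'\le q$, $R^*\ge\max\{1,V_{q'}(\mathbf x^* )\}$, and $\lambda_0=\frac{\epsilon}{2R^*}$. Suppose that: (i) with $\varrho=q/(q-1)$, there are deterministic functions $F_1,F_2:\mathcal X\to\mathbb R$ with $F=F_1+F_2$ on $\mathcal X$ and constants $\mathcal L\ge1$, $\mathcal M\ge1$ such that $F_1$ is everywhere differentiable with $\|\nabla F_1(\mathbf x_1)-\nabla F_1(\mathbf x_2)\|_\varrho\le\mathcal L\|\mathbf x_1-\mathbf x_2\|_q$ for all $\mathbf x_1,\mathbf x_2\in\mathcal X$, and such that, for every $\mathbf x\in\mathcal X$ and every $\mathbf g\in\{\mathbf g_F-\nabla F_1(\mathbf x):\mathbf g_F\in\partial F(\mathbf x)\}$, $\|\mathbf g\|_\varrho\le\mathcal M$; (ii) for some $p$ with $1\le p\le\frac{q}{q-1}$ and some $\sigma_p\ge1$, the expectation $\mathbb E[G(\mathbf x,\xi)]$ is well-defined and finite-valued for every $\mathbf x\in\mathcal X$ and $\mathbb E\big[\|G(\mathbf x,\xi)-\mathbb E[G(\mathbf x,\xi)]\|_p^2\big]\le\sigma_p^2$ for all $\mathbf x\in\mathcal X$; (iii) for almost every $\xi\in\Xi$, $f(\cdot,\xi)$ is convex on $B$. Let $\widehat{\mathbf x}$ be any $(\delta,q)$-approximate solution to the regularized SAA problem $\min_{\mathbf x\in\mathcal X}F_{\lambda_0,N}(\mathbf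 x)$ with $\delta\le1/N$. Then $$\mathbb E\left[F(\widehat{\mathbf x})-F(\mathbf x^* )\right]\le\epsilon\quad\text{if}\quad N\ge\frac{C_2R^*}{q'-1}\max\left\{\frac{\mathcal L}{\epsilon},\ \frac{\sigma_p^2+\mathcal M^2}{\epsilon^2}\right\},$$ and, for any $\beta\in(0,1)$, $$\Pr\left[F(\widehat{\mathbf x})-F(\mathbf x^* )\le\epsilon\right]\ge1-\beta\quad\text{if}\quad N\ge\frac{C_2R^*}{q'-1}\max\left\{\frac{\mathcal L}{\epsilon},\ \frac{\sigma_p^2+\mathcal M^2}{\beta\epsilon^2}\right\}.$$
   Context: Setting. $(\Omega,\mathcal F,\Pr)$ is a complete probability space, $\Xi$ is a Borel subset of $\mathbb R^m$, and $\xi$ is a $\Xi$-valued random vector with distribution $P$. $B\subseteq\mathbb R^d$ is open and convex, $\mathcal X\subseteq B$ is non-empty, closed and convex, and $f:B\times\Xi\to\mathbb R$ is $\mathcal B(B)\otimes\mathcal B(\Xi)$-measurable. $F(\mathbf x):=\mathbb E[f(\mathbf x,\xi)]$ is well-defined and finite for all $\mathbf x\in\mathcal X$ and admits a minimizer $\mathbf x^*$ on $\mathcal X$. $G:\mathcal X\times\Xi\to\mathbb R^d$ is a deterministic, universally measurable function such that, for all $\mathbf x\in\mathcal X$, $G(\mathbf x,\xi)\in\partial_{\mathbf x}f(\mathbf x,\xi)$ for almost every $\xi\in\Xi$. Here $\partial$ (or $\partial_{\mathbf x}$) denotes the subdifferential of convex analysis (with respect to $\mathbf x$), and $\|\cdot\|_p$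 is the usual $p$-norm on $\mathbb R^d$. Regularized SAA. For a positive integer $N$, $\boldsymbol\xi_{1,N}=(\xi_1,\dots,\xi_N)$ is an i.i.d. sample of $\xi$ and $F_N(\mathbf x):=N^{-1}\sum_{j=1}^Nf(\mathbf x,\xi_j)$. For $q'\in(1,2]$ and a fixed initial guess $\mathbf x^0\in\mathcal X$, $V_{q'}(\mathbf x):=\frac12\|\mathbf x-\mathbf x^0\|_{q'}^2$, and $F_{\lambda_0,N}(\mathbf x):=F_N(\mathbf x)+\lambda_0V_{q'}(\mathbf x)$. Approximate solution. For $q\ge1$ and $\delta\ge0$, a random vector $\widehat{\mathbf x}=\widetilde{\mathbf x}(\boldsymbol\xi_{1,N})\in\mathcal X$ is a $(\delta,q)$-approximate solution to $\min_{\mathbf x\in\mathcal X}F_{\lambda_0,N}(\mathbf x)$ if $\widetilde{\mathbf x}:\Xi^N\to\mathcal X$ is a deterministic $\mathcal B(\Xi^N)$-measurable function such that, for some $\mathbf g\in\partial F_{\lambda_0,N}(\widetilde{\mathbf x}(\boldsymbol\xi_{1,N}))$, $\langle\mathbf g,\mathbf x-\widetilde{\mathbf x}(\boldsymbol\xi_{1,N})\rangle\ge-\delta\|\mathbf x-\widetilde{\mathbf x}(\boldsymbol\xi_{1,N})\|_q$ for all $\mathbf x\in\mathcal X$. *)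

theory Defs
  imports "HOL-Probability.Probability"
begin

(* The constant of the theorem is absolute, so the dimensions must be quantified after it. Hence
   R^d is the carrier of Euclidean_space d, i.e. the sequences nat => real that vanish from
   index d on; coordinates are numbered 0, ..., d-1. The type nat => real carries the product
   topology, whose trace on this carrier is the Euclidean one; Borel sigma-algebras of subsets S
   are therefore restrict_space borel S. *)

type_synonym vec = "nat \<Rightarrow> real"

abbreviation Rn :: "nat \<Rightarrow> vec set" where
  "Rn d \<equiv> topspace (Euclidean_space d)"

abbreviation borel_on :: "vec set \<Rightarrow> vec measure" where
  "borel_on S \<equiv> restrict_space borel S"

definition pnorm :: "nat \<Rightarrow> real \<Rightarrow> vec \<Rightarrow> real" where
  "pnorm d p x = (\<Sum>i<d. \<bar>x i\<bar> powr p) powr (1 / p)"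

definition dot :: "nat \<Rightarrow> vec \<Rightarrow> vec \<Rightarrow> real" where
  "dot d x y = (\<Sum>i<d. x i * y i)"

definition vdiff :: "vec \<Rightarrow> vec \<Rightarrow> vec" where
  "vdiff x y = (\<lambda>i. x i - y i)"

definition cvx_comb :: "real \<Rightarrow> vec \<Rightarrow> vec \<Rightarrow> vec" where
  "cvx_comb t x y = (\<lambda>i. (1 - t) * x i + t * y i)"

(* The library's convex and convex_on need a real_vector instance, which nat => real lacks. *)
definition vconvex :: "vec set \<Rightarrow> bool" where
  "vconvex S \<longleftrightarrow> (\<forall>x\<in>S. \<forall>y\<in>S. \<forall>t\<in>{0..1}. cvx_comb t x y \<in> S)"

definition vconvex_on :: "vec set \<Rightarrow> (vec \<Rightarrow> real) \<Rightarrow> bool" where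
  "vconvex_on S h \<longleftrightarrow> vconvex S \<and>
     (\<forall>x\<in>S. \<forall>y\<in>S. \<forall>t\<in>{0..1}. h (cvx_comb t x y) \<le> (1 - t) * h x + t * h y)"

(* Subdifferential of the extended-real-valued function on R^d that equals h on its effective
   domain D and +infinity elsewhere. *)
definition subdifferential :: "nat \<Rightarrow> vec set \<Rightarrow> (vec \<Rightarrow> real) \<Rightarrow> vec \<Rightarrow> vec set" where
  "subdifferential d D h x =
     {g \<in> Rn d. x \<in> D \<and> (\<forall>y\<in>D. h x + dot d g (vdiff y x) \<le> h y)}"

(* Frechet differentiability at x relative to S. *)
definition has_gradient_within :: "nat \<Rightarrow> (vec \<Rightarrow> real) \<Rightarrow> vec \<Rightarrow> vec \<Rightarrow> vec set \<Rightarrow> bool" where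
  "has_gradient_within d h g x S \<longleftrightarrow> g \<in> Rn d \<and>
     ((\<lambda>y. (h y - h x - dot d g (vdiff y x)) / pnorm d 2 (vdiff y x)) \<longlongrightarrow> 0) (at x within S)"

definition universally_measurable :: "'a measure \<Rightarrow> 'b measure \<Rightarrow> ('a \<Rightarrow> 'b) \<Rightarrow> bool" where
  "universally_measurable S T h \<longleftrightarrow>
     (\<forall>\<mu>. finite_measure \<mu> \<and> sets \<mu> = sets S \<longrightarrow> h \<in> measurable (completion \<mu>) T)"

(* Omega is the space of the measure M. *)
locale stochastic_program = prob_space M + complete_measure M for M :: "'w measure" +
  fixes d m :: nat
    and \<Xi> :: "vec set" and \<xi> :: "'w \<Rightarrow> vec"
    and B X :: "vec set"
    and f :: "vec \<Rightarrow> vec \<Rightarrow> real"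
    and G :: "vec \<Rightarrow> vec \<Rightarrow> vec"
  assumes dims: "0 < d" "0 < m"
    and \<Xi>_borel: "\<Xi> \<in> sets borel" "\<Xi> \<subseteq> Rn m"
    and \<xi>_rv: "\<xi> \<in> measurable M (borel_on \<Xi>)"
    and B_open: "openin (Euclidean_space d) B"
    and B_convex: "vconvex B"
    and X_subset: "X \<subseteq> B"
    and X_nonempty: "X \<noteq> {}"
    and X_closed: "closedin (Euclidean_space d) X"
    and X_convex: "vconvex X"
    and f_measurable: "(\<lambda>(x, z). f x z) \<in> borel_measurable (borel_on B \<Otimes>\<^sub>M borel_on \<Xi>)"
    and f_integrable: "\<And>x. x \<in> X \<Longrightarrow> integrable M (\<lambda>\<omega>. f x (\<xi> \<omega>))"
    and G_universally_measurable:
      "universally_measurable (borel_on X \<Otimes>\<^sub>M borel_on \<Xi>) (borel_on (Rn d)) (\<lambda>(x, z). G x z)"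
    and G_subgradient:
      "\<And>x. x \<in> X \<Longrightarrow> AE z in distr M (borel_on \<Xi>) \<xi>. G x z \<in> subdifferential d B (\<lambda>y. f y z) x"

definition objective :: "'w measure \<Rightarrow> ('w \<Rightarrow> vec) \<Rightarrow> (vec \<Rightarrow> vec \<Rightarrow> real) \<Rightarrow> vec \<Rightarrow> real" where
  "objective M \<xi> f x = (\<integral>\<omega>. f x (\<xi> \<omega>) \<partial>M)"

(* Effective domain of F on B. If F is finite on X, f(., xi) is a.s. convex and E[G(x, xi)] exists,
   then f(y, xi) has an integrable minorant for every y in B, so that E[f(y, xi)] = +infinity
   exactly when f(y, xi) is not integrable. *)
definition objective_dom ::
    "'w measure \<Rightarrow> ('w \<Rightarrow> vec) \<Rightarrow> (vec \<Rightarrow> vec \<Rightarrow> real) \<Rightarrow> vec set \<Rightarrow> vec set" where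
  "objective_dom M \<xi> f B = {y \<in> B. integrable M (\<lambda>\<omega>. f y (\<xi> \<omega>))}"

definition iid_sample ::
    "'w measure \<Rightarrow> vec set \<Rightarrow> ('w \<Rightarrow> vec) \<Rightarrow> nat \<Rightarrow> (nat \<Rightarrow> 'w \<Rightarrow> vec) \<Rightarrow> bool" where
  "iid_sample M \<Xi> \<xi> N \<xi>s \<longleftrightarrow>
     prob_space.indep_vars M (\<lambda>_. borel_on \<Xi>) \<xi>s {1..N} \<and>
     (\<forall>j\<in>{1..N}. distr M (borel_on \<Xi>) (\<xi>s j) = distr M (borel_on \<Xi>) \<xi>)"

definition sample_vector :: "nat \<Rightarrow> (nat \<Rightarrow> 'w \<Rightarrow> vec) \<Rightarrow> 'w \<Rightarrow> nat \<Rightarrow> vec" where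
  "sample_vector N \<xi>s \<omega> = (\<lambda>j\<in>{1..N}. \<xi>s j \<omega>)"

definition reg_V :: "nat \<Rightarrow> real \<Rightarrow> vec \<Rightarrow> vec \<Rightarrow> real" where
  "reg_V d q' x0 x = (pnorm d q' (vdiff x x0))\<^sup>2 / 2"

definition F_reg :: "nat \<Rightarrow> (vec \<Rightarrow> vec \<Rightarrow> real) \<Rightarrow> real \<Rightarrow> vec \<Rightarrow> real \<Rightarrow> nat \<Rightarrow> (nat \<Rightarrow> vec) \<Rightarrow>
    vec \<Rightarrow> real" where
  "F_reg d f q' x0 lam N s x = (\<Sum>j=1..N. f x (s j)) / real N + lam * reg_V d q' x0 x"

(* xt is the map from samples to points of X. The defining inequality is required for almost every
   sample with respect to the law of the sample. *)
definition approx_solution ::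
    "nat \<Rightarrow> vec set \<Rightarrow> vec measure \<Rightarrow> vec set \<Rightarrow> vec set \<Rightarrow> (vec \<Rightarrow> vec \<Rightarrow> real) \<Rightarrow>
     real \<Rightarrow> vec \<Rightarrow> real \<Rightarrow> nat \<Rightarrow> real \<Rightarrow> real \<Rightarrow> ((nat \<Rightarrow> vec) \<Rightarrow> vec) \<Rightarrow> bool" where
  "approx_solution d \<Xi> P B X f q' x0 lam N \<delta> q xt \<longleftrightarrow>
     xt \<in> measurable (\<Pi>\<^sub>M j\<in>{1..N}. borel_on \<Xi>) (borel_on X) \<and>
     (AE s in (\<Pi>\<^sub>M j\<in>{1..N}. P).
        \<exists>g \<in> subdifferential d B (F_reg d f q' x0 lam N s) (xt s).
          \<forall>x\<in>X. dot d g (vdiff x (xt s)) \<ge> - \<delta> * pnorm d q (vdiff x (xt s)))"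

definition composite_structure ::
    "nat \<Rightarrow> vec set \<Rightarrow> vec set \<Rightarrow> (vec \<Rightarrow> real) \<Rightarrow> real \<Rightarrow> real \<Rightarrow> real \<Rightarrow> bool" where
  "composite_structure d D X F q \<L> \<M> \<longleftrightarrow>
     (\<exists>F1 F2 DF1.
        (\<forall>x\<in>X. F x = F1 x + F2 x) \<and>
        (\<forall>x\<in>X. has_gradient_within d F1 (DF1 x) x X) \<and>
        (\<forall>x1\<in>X. \<forall>x2\<in>X. pnorm d (q / (q - 1)) (vdiff (DF1 x1) (DF1 x2))
                         \<le> \<L> * pnorm d q (vdiff x1 x2)) \<and>
        (\<forall>x\<in>X. \<forall>gF \<in> subdifferential d D F x.
            pnorm d (q / (q - 1)) (vdiff gF (DF1 x)) \<le> \<M>))"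

definition bounded_variance ::
    "'w measure \<Rightarrow> nat \<Rightarrow> ('w \<Rightarrow> vec) \<Rightarrow> vec set \<Rightarrow> (vec \<Rightarrow> vec \<Rightarrow> vec) \<Rightarrow> real \<Rightarrow> real \<Rightarrow> bool" where
  "bounded_variance M d \<xi> X G p \<sigma> \<longleftrightarrow>
     (\<forall>x\<in>X. (\<forall>i<d. integrable M (\<lambda>\<omega>. G x (\<xi> \<omega>) i)) \<and>
        (\<integral>\<^sup>+\<omega>. ennreal ((pnorm d p (vdiff (G x (\<xi> \<omega>)) (\<lambda>i. \<integral>\<omega>'. G x (\<xi> \<omega>') i \<partial>M)))\<^sup>2) \<partial>M)
          \<le> ennreal (\<sigma>\<^sup>2))"

(* The sample size guarantee with constant C, for all problems on probability spaces whose
   outcomes have type 'w. *)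
definition sample_size_guarantee :: "'w itself \<Rightarrow> real \<Rightarrow> bool" where
  "sample_size_guarantee T C \<longleftrightarrow>
    (\<forall>(M :: 'w measure) d m \<Xi> \<xi> B X f G xs x0 N \<xi>s q q' \<epsilon> R lam \<L> \<M> p \<sigma> \<delta> xt.
      stochastic_program M d m \<Xi> \<xi> B X f G \<and>
      xs \<in> X \<and> (\<forall>x\<in>X. objective M \<xi> f xs \<le> objective M \<xi> f x) \<and>
      x0 \<in> X \<and>
      N \<ge> 1 \<and> iid_sample M \<Xi> \<xi> N \<xi>s \<and>
      q > 1 \<and> 0 < \<epsilon> \<and> \<epsilon> \<le> 1 \<and>
      1 < q' \<and> q' \<le> 2 \<and> q' \<le> q \<and>
      R \<ge> max 1 (reg_V d q' x0 xs) \<and> lam = \<epsilon> / (2 * R) \<and>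
      \<L> \<ge> 1 \<and> \<M> \<ge> 1 \<and>
      composite_structure d (objective_dom M \<xi> f B) X (objective M \<xi> f) q \<L> \<M> \<and>
      1 \<le> p \<and> p \<le> q / (q - 1) \<and> \<sigma> \<ge> 1 \<and>
      bounded_variance M d \<xi> X G p \<sigma> \<and>
      (AE z in distr M (borel_on \<Xi>) \<xi>. vconvex_on B (\<lambda>x. f x z)) \<and>
      0 \<le> \<delta> \<and> \<delta> \<le> 1 / real N \<and>
      approx_solution d \<Xi> (distr M (borel_on \<Xi>) \<xi>) B X f q' x0 lam N \<delta> q xt
      \<longrightarrow>
      (let gap = (\<lambda>\<omega>. objective M \<xi> f (xt (sample_vector N \<xi>s \<omega>)) - objective M \<xi> f xs)
       in (real N \<ge> C * R / (q' - 1) * max (\<L> / \<epsilon>) ((\<sigma>\<^sup>2 + \<M>\<^sup>2) / \<epsilon>\<^sup>2) \<longrightarrow>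
             integrable M gap \<and> (\<integral>\<omega>. gap \<omega> \<partial>M) \<le> \<epsilon>) \<and>
          (\<forall>\<beta>. 0 < \<beta> \<and> \<beta> < 1 \<and>
             real N \<ge> C * R / (q' - 1) * max (\<L> / \<epsilon>) ((\<sigma>\<^sup>2 + \<M>\<^sup>2) / (\<beta> * \<epsilon>\<^sup>2)) \<longrightarrow>
             \<P>(\<omega> in M. gap \<omega> \<le> \<epsilon>) \<ge> 1 - \<beta>)))"

(* HOL cannot quantify over types, and the constant in "EX C. sample_size_guarantee TYPE('w) C"
   could depend on 'w. An absolute constant is expressed by fixing one outcome type: some C > 0 is
   valid for it, and every C > 0 valid for it is valid for every other outcome type. *)
type_synonym reference_outcome = "nat \<Rightarrow> vec"

end

theory Submission
  imports Defs
begin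

text \<open>The regularizer is strongly convex with modulus \<open>q' - 1\<close> for the \<open>q\<close>-norm. Hence, when one sample is
  replaced by an independent copy, the approximate solution moves by \<open>O(1 / (\<lambda>\<^sub>0 (q' - 1) N))\<close> times a
  random factor with second moment \<open>O(\<sigma>\<^sub>p\<^sup>2 + \<M>\<^sup>2)\<close>. Exchanging a sample with its copy preserves the joint
  law, so the expected difference between out-of-sample and in-sample values at the approximate solution is
  half the expectation of a symmetrized quantity. In it only the differences of \<open>\<nabla>F\<^sub>1\<close> at the two solutions
  occur, and these are controlled by \<open>\<L>\<close> although \<open>\<nabla>F\<^sub>1\<close> itself is unbounded. For the tail bound, Markov's
  inequality is applied to the gap of the regularized objective above its infimum, because the bias
  \<open>\<epsilon> / 2\<close> of the regularization does not decrease with \<open>\<beta>\<close>.\<close>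

section \<open>Norm inequalities\<close>

text \<open>An observation and the solution computed from it are dependent, while the noise of
  \<open>G\<close> has a second moment bound only at deterministic points. The noise is therefore
  used only at pairs of a solution and an observation that did not enter it; the exchange of entries
  is arranged to produce such pairs. Since \<open>G\<close> is merely universally measurable and its
  exceptional null set depends on the point, even this takes a Borel version of \<open>G\<close> and
  a countable set of comparison points. The two parts of the sample size have different origins:
  \<open>\<L> / \<epsilon>\<close> lets strong convexity, scaled by \<open>N\<close>, outweigh the
  curvature of \<open>F\<^sub>1\<close>, whereas
  \<open>(\<sigma>\<^sup>2 + \<M>\<^sup>2) / \<epsilon>\<^sup>2\<close> stems from the second moment
  of the stability factor. As all conclusions depend only on the law of the sample, a problem can be
  moved to the product space of samples, whose points have the reference type; this makes the
  constant independent of the outcome type.\<close>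

lemma pnorm_nonneg [simp]: "0 \<le> pnorm d p x"
  by (simp add: pnorm_def)

lemma pnorm_vdiff_commute: "pnorm d p (vdiff x y) = pnorm d p (vdiff y x)"
  by (simp add: pnorm_def vdiff_def abs_minus_commute)

lemma pnorm_powr:
  assumes "p > 0"
  shows "pnorm d p x powr p = (\<Sum>i<d. \<bar>x i\<bar> powr p)"
  using assms by (simp add: pnorm_def powr_powr sum_nonneg)

lemma pnorm_eq_0D:
  assumes "p > 0" "pnorm d p x = 0" "i < d"
  shows "x i = 0"
proof -
  have "(\<Sum>i<d. \<bar>x i\<bar> powr p) = 0"
    using pnorm_powr[OF assms(1), of d x] assms by simp
  then have "\<bar>x i\<bar> powr p = 0"
    using assms(3) by (subst (asm) sum_nonneg_eq_0_iff) auto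
  then show ?thesis by simp
qed

lemma abs_le_pnorm:
  assumes "p > 0" "i < d"
  shows "\<bar>x i\<bar> \<le> pnorm d p x"
proof -
  have "\<bar>x i\<bar> powr p \<le> (\<Sum>i<d. \<bar>x i\<bar> powr p)"
    using assms by (intro member_le_sum) auto
  then have "(\<bar>x i\<bar> powr p) powr (1/p) \<le> pnorm d p x"
    unfolding pnorm_def using assms by (intro powr_mono2) auto
  then show ?thesis using assms by (simp add: powr_powr)
qed

text \<open>Relative to \<open>pnorm d p x\<close> every coordinate has modulus at most 1, and on
  the unit interval powers decrease in the exponent.\<close>

lemma pnorm_mono_exponent:
  assumes "0 < p" "p \<le> r"
  shows "pnorm d r x \<le> pnorm d p x"
proof (cases "pnorm d p x = 0")
  case True
  then have "\<bar>x i\<bar> powr r = 0" if "i < d" for i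
    using pnorm_eq_0D[OF assms(1) _ that, of x] by simp
  then have "pnorm d r x = 0" by (simp add: pnorm_def)
  then show ?thesis by simp
next
  case False
  define A where "A = pnorm d p x"
  have A: "A > 0" using False pnorm_nonneg[of d p x] unfolding A_def by linarith
  have "(\<Sum>i<d. \<bar>x i\<bar> powr r) = (\<Sum>i<d. A powr r * (\<bar>x i\<bar> / A) powr r)"
    using A by (intro sum.cong) (auto simp: powr_divide)
  also have "\<dots> \<le> (\<Sum>i<d. A powr r * (\<bar>x i\<bar> / A) powr p)"
    using A assms abs_le_pnorm[OF assms(1), of _ d x]
    by (intro sum_mono mult_left_mono powr_mono') (auto simp: A_def)
  also have "\<dots> = A powr r * ((\<Sum>i<d. \<bar>x i\<bar> powr p) / A powr p)"
    using A by (simp add: powr_divide sum_distrib_left sum_divide_distrib)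
  also have "\<dots> = A powr r"
    using A by (simp add: A_def pnorm_powr[OF assms(1), symmetric])
  finally have "pnorm d r x \<le> (A powr r) powr (1/r)"
    unfolding pnorm_def using assms by (intro powr_mono2) (auto intro: sum_nonneg)
  then show ?thesis using A assms by (simp add: powr_powr A_def)
qed

text \<open>Hoelder's inequality: Young's inequality is applied to the normalized coordinates, whose
  powers sum to one.\<close>

lemma abs_dot_le_pnorm:
  assumes "q > 1"
  shows "\<bar>dot d x y\<bar> \<le> pnorm d (q / (q - 1)) x * pnorm d q y"
proof (cases "pnorm d (q / (q - 1)) x = 0 \<or> pnorm d q y = 0")
  case True
  then have "x i * y i = 0" if "i < d" for i
    using pnorm_eq_0D[of "q / (q - 1)" d x i] pnorm_eq_0D[of q d y i] that assms by auto
  then have "dot d x y = 0" unfolding dot_def by (intro sum.neutral) auto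
  then show ?thesis by simp
next
  case False
  define r where "r = q / (q - 1)"
  define a where "a = pnorm d r x"
  define b where "b = pnorm d q y"
  have r: "r > 1" "1 / r + 1 / q = 1"
    using assms by (auto simp: r_def field_simps)
  have ab: "a > 0" "b > 0"
    using False pnorm_nonneg[of d r x] pnorm_nonneg[of d q y] unfolding a_def b_def r_def by linarith+
  have "\<bar>dot d x y\<bar> \<le> (\<Sum>i<d. \<bar>x i\<bar> * \<bar>y i\<bar>)"
    unfolding dot_def by (rule order.trans[OF sum_abs]) (simp add: abs_mult)
  also have "\<dots> = a * b * (\<Sum>i<d. (\<bar>x i\<bar> / a) * (\<bar>y i\<bar> / b))"
    using ab by (simp add: sum_distrib_left)
  also have "\<dots> \<le> a * b * (\<Sum>i<d. (\<bar>x i\<bar> / a) powr r / r + (\<bar>y i\<bar> / b) powr q / q)"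
    using ab r assms by (intro mult_left_mono sum_mono Youngs_inequality) auto
  also have "(\<Sum>i<d. (\<bar>x i\<bar> / a) powr r / r + (\<bar>y i\<bar> / b) powr q / q)
      = (\<Sum>i<d. \<bar>x i\<bar> powr r) / a powr r / r + (\<Sum>i<d. \<bar>y i\<bar> powr q) / b powr q / q"
    using ab by (simp add: powr_divide sum.distrib sum_divide_distrib)
  also have "\<dots> = 1"
    using ab r assms by (simp add: a_def b_def pnorm_powr[symmetric])
  finally show ?thesis by (simp add: a_def b_def r_def)
qed

lemma dot_le_pnorm:
  assumes "q > 1"
  shows "dot d x y \<le> pnorm d (q / (q - 1)) x * pnorm d q y"
  using abs_dot_le_pnorm[OF assms, of d x y] by linarith

section \<open>Concave powers and the two-point inequality\<close>

lemma powr_tangent_le: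
  fixes u m \<theta> :: real
  assumes "0 \<le> u" "0 < m" "0 < \<theta>" "\<theta> \<le> 1"
  shows "u powr \<theta> \<le> m powr (\<theta> - 1) * (\<theta> * u + (1 - \<theta>) * m)"
proof (cases "u = 0")
  case False
  \<comment> \<open>Weighted arithmetic-geometric mean inequality; division by
    \<open>m powr (1 - \<theta>)\<close> turns it into the tangent line of the concave power at
    \<open>m\<close>.\<close>
  then have "u powr \<theta> * m powr (1 - \<theta>) \<le> \<theta> * u + (1 - \<theta>) * m"
    using assms by (intro Youngs_inequality_0) auto
  then have "m powr (\<theta> - 1) * (u powr \<theta> * m powr (1 - \<theta>)) \<le> m powr (\<theta> - 1) * (\<theta> * u + (1 - \<theta>) * m)"
    by (intro mult_left_mono) auto
  moreover have "m powr (\<theta> - 1) * (u powr \<theta> * m powr (1 - \<theta>)) = u powr \<theta>"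
    using assms by (simp add: powr_add[symmetric] mult.left_commute)
  ultimately show ?thesis by simp
qed (use assms in auto)

text \<open>The tangent bound at the weighted mean \<open>m\<close> is averaged over both points; a
  vanishing mean is split off, as the tangent is taken at a positive point.\<close>

lemma powr_concave:
  fixes u v \<alpha> \<beta> \<theta> :: real
  assumes "0 \<le> u" "0 \<le> v" "0 \<le> \<alpha>" "0 \<le> \<beta>" "\<alpha> + \<beta> = 1" "0 < \<theta>" "\<theta> \<le> 1"
  shows "\<alpha> * u powr \<theta> + \<beta> * v powr \<theta> \<le> (\<alpha> * u + \<beta> * v) powr \<theta>"
proof (cases "\<alpha> * u + \<beta> * v = 0")
  case True
  then have "\<alpha> * u = 0" "\<beta> * v = 0"
    using assms by (smt (verit) mult_nonneg_nonneg)+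
  then show ?thesis using assms by auto
next
  case False
  define m where "m = \<alpha> * u + \<beta> * v"
  have m: "m > 0" using False assms unfolding m_def by (smt (verit) mult_nonneg_nonneg)
  have "\<alpha> * u powr \<theta> + \<beta> * v powr \<theta> \<le>
      \<alpha> * (m powr (\<theta> - 1) * (\<theta> * u + (1 - \<theta>) * m)) + \<beta> * (m powr (\<theta> - 1) * (\<theta> * v + (1 - \<theta>) * m))"
    using assms m by (intro add_mono mult_left_mono powr_tangent_le) auto
  also have "\<dots> = m powr (\<theta> - 1) * (\<theta> * (\<alpha> * u + \<beta> * v) + (1 - \<theta>) * ((\<alpha> + \<beta>) * m))"
    by (simp add: algebra_simps)
  also have "\<dots> = m powr (\<theta> - 1) * m"
    using assms(5) by (simp add: m_def[symmetric] algebra_simps)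
  also have "\<dots> = m powr \<theta>"
    using m by (simp add: powr_mult_base mult.commute)
  finally show ?thesis by (simp add: m_def)
qed

text \<open>The difference of the two sides has derivative \<open>p * k\<close>, and
  \<open>k\<close> increases from 0: the two powers in its derivative have product
  \<open>(1 - s\<^sup>2) powr (r - 1)\<close>, which is at least 1 since \<open>r \<le> 1\<close>,
  so their sum is at least 2.\<close>

lemma one_plus_minus_powr_ge:
  fixes p b :: real
  assumes p: "1 < p" "p \<le> 2" and b: "0 \<le> b" "b \<le> 1"
  shows "2 + p * (p - 1) * b\<^sup>2 \<le> (1 + b) powr p + (1 - b) powr p"
proof -
  define r where "r = p - 1"
  have r: "0 < r" "r \<le> 1" using p by (auto simp: r_def)
  define k where "k = (\<lambda>t. (1 + t) powr r - (1 - t) powr r - 2 * r * t)"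
  have k: "k t \<ge> 0" if t: "0 \<le> t" "t < 1" for t
  proof -
    have "k 0 \<le> k t"
    proof (rule DERIV_nonneg_imp_nondecreasing[OF t(1)])
      fix s assume s: "0 \<le> s" "s \<le> t"
      have s1: "s < 1" using s t by simp
      have D: "(k has_real_derivative r * (1 + s) powr (r - 1) + r * (1 - s) powr (r - 1) - 2 * r) (at s)"
        unfolding k_def using s s1 by (auto intro!: derivative_eq_intros)
      have "1 \<le> (1 - s\<^sup>2) powr (r - 1)"
      proof -
        have "0 < 1 - s\<^sup>2" "1 - s\<^sup>2 \<le> 1" using s s1 by (auto simp: power_less_one_iff abs_square_less_1)
        then have "(1 - s\<^sup>2) powr 0 \<le> (1 - s\<^sup>2) powr (r - 1)" using r by (intro powr_mono') auto
        then show ?thesis using \<open>0 < 1 - s\<^sup>2\<close> by simp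
      qed
      also have "(1 - s\<^sup>2) powr (r - 1) = (1 + s) powr (r - 1) * (1 - s) powr (r - 1)"
        using s s1 by (subst powr_mult[symmetric]) (auto simp: power2_eq_square algebra_simps)
      finally have uv: "1 \<le> (1 + s) powr (r - 1) * (1 - s) powr (r - 1)" .
      have amgm: "2 \<le> u + v" if "0 \<le> u" "0 \<le> v" "1 \<le> u * v" for u v :: real
      proof (rule ccontr)
        assume "\<not> 2 \<le> u + v"
        then have "(u + v)\<^sup>2 < 2\<^sup>2" using that by (intro power_strict_mono) auto
        moreover have "(u + v)\<^sup>2 = (u - v)\<^sup>2 + 4 * (u * v)" by (simp add: power2_eq_square algebra_simps)
        ultimately show False using that zero_le_power2[of "u - v"] by simp
      qed
      have "2 \<le> (1 + s) powr (r - 1) + (1 - s) powr (r - 1)"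
        by (rule amgm[OF _ _ uv]) auto
      then have "r * 2 \<le> r * ((1 + s) powr (r - 1) + (1 - s) powr (r - 1))"
        using r by (intro mult_left_mono) auto
      then have "0 \<le> r * (1 + s) powr (r - 1) + r * (1 - s) powr (r - 1) - 2 * r"
        by (simp add: algebra_simps)
      then show "\<exists>y. (k has_real_derivative y) (at s) \<and> 0 \<le> y" using D by blast
    qed
    then show ?thesis by (simp add: k_def)
  qed
  define h where "h = (\<lambda>t. (1 + t) powr p + (1 - t) powr p - p * (p - 1) * t\<^sup>2)"
  have "h 0 \<le> h b"
  proof (cases "b = 0")
    case False
    then have "0 < b" using b by simp
    \<comment> \<open>For \<open>b = 1\<close> the base \<open>1 - t\<close> vanishes at the right
      end, so derivatives are taken on the open interval and continuity covers the ends.\<close>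
    show ?thesis
    proof (rule DERIV_nonneg_imp_increasing_open[OF b(1)])
      fix s assume s: "0 < s" "s < b"
      have D: "(h has_real_derivative p * k s) (at s)"
        unfolding h_def k_def r_def using s b
        by (auto intro!: derivative_eq_intros simp: algebra_simps)
      have "0 \<le> p * k s" using k[of s] s b p by simp
      then show "\<exists>y. (h has_real_derivative y) (at s) \<and> 0 \<le> y" using D by blast
    next
      show "continuous_on {0..b} h"
        unfolding h_def using b p by (intro continuous_intros continuous_on_powr') auto
    qed
  qed simp
  then show ?thesis by (simp add: h_def)
qed

lemma power2_powr_half: "(x\<^sup>2) powr (p / 2) = \<bar>x\<bar> powr p" for x p :: real
proof -
  have "\<bar>x\<bar> powr p = (\<bar>x\<bar> powr 2) powr (p / 2)" by (simp only: powr_powr) simp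
  then show ?thesis by simp
qed

lemma two_point_inequality_aux:
  fixes p s t :: real
  assumes p: "1 < p" "p \<le> 2" and st: "\<bar>t\<bar> \<le> \<bar>s\<bar>"
  shows "2 * (s\<^sup>2 + (p - 1) * t\<^sup>2) powr (p / 2) \<le> \<bar>s + t\<bar> powr p + \<bar>s - t\<bar> powr p"
proof (cases "s = 0")
  case False
  define b where "b = \<bar>t\<bar> / \<bar>s\<bar>"
  have b: "0 \<le> b" "b \<le> 1" using st False by (auto simp: b_def divide_simps)
  have t: "\<bar>t\<bar> = \<bar>s\<bar> * b" using False by (simp add: b_def)
  have t2: "t\<^sup>2 = s\<^sup>2 * b\<^sup>2" using arg_cong[OF t, of "\<lambda>x. x\<^sup>2"] by (simp add: power_mult_distrib)
  \<comment> \<open>The tangent at 1 turns the left side into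
    \<open>1 + p * (p - 1) * b\<^sup>2 / 2\<close>, half of the lower bound in
    \<open>one_plus_minus_powr_ge\<close>.\<close>
  have "(1 + (p - 1) * b\<^sup>2) powr (p / 2) \<le> 1 powr (p / 2 - 1) * (p / 2 * (1 + (p - 1) * b\<^sup>2) + (1 - p / 2) * 1)"
    using p by (intro powr_tangent_le) auto
  also have "\<dots> = 1 + p * (p - 1) * b\<^sup>2 / 2"
    by (simp add: field_simps)
  finally have 1: "2 * (1 + (p - 1) * b\<^sup>2) powr (p / 2) \<le> (1 + b) powr p + (1 - b) powr p"
    using one_plus_minus_powr_ge[OF p b] by simp
  have "s\<^sup>2 + (p - 1) * t\<^sup>2 = s\<^sup>2 * (1 + (p - 1) * b\<^sup>2)"
    by (simp add: t2 algebra_simps)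
  then have "(s\<^sup>2 + (p - 1) * t\<^sup>2) powr (p / 2) = (s\<^sup>2) powr (p / 2) * (1 + (p - 1) * b\<^sup>2) powr (p / 2)"
    using p by (simp add: powr_mult)
  also have "(s\<^sup>2) powr (p / 2) = \<bar>s\<bar> powr p"
    by (rule power2_powr_half)
  finally have "2 * (s\<^sup>2 + (p - 1) * t\<^sup>2) powr (p / 2) = \<bar>s\<bar> powr p * (2 * (1 + (p - 1) * b\<^sup>2) powr (p / 2))"
    by simp
  also have "\<dots> \<le> \<bar>s\<bar> powr p * ((1 + b) powr p + (1 - b) powr p)"
    using 1 by (intro mult_left_mono) auto
  also have "\<dots> = (\<bar>s\<bar> + \<bar>t\<bar>) powr p + (\<bar>s\<bar> - \<bar>t\<bar>) powr p"
    using b by (simp add: t powr_mult[symmetric] algebra_simps)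
  also have "\<dots> = \<bar>s + t\<bar> powr p + \<bar>s - t\<bar> powr p"
  proof (cases "s * t \<ge> 0")
    case True
    then have "\<bar>s + t\<bar> = \<bar>s\<bar> + \<bar>t\<bar>" "\<bar>s - t\<bar> = \<bar>s\<bar> - \<bar>t\<bar>"
      using st by (auto simp: zero_le_mult_iff)
    then show ?thesis by simp
  next
    case False
    then have "\<bar>s + t\<bar> = \<bar>s\<bar> - \<bar>t\<bar>" "\<bar>s - t\<bar> = \<bar>s\<bar> + \<bar>t\<bar>"
      using st by (auto simp: zero_le_mult_iff)
    then show ?thesis by simp
  qed
  finally show ?thesis .
qed (use assms in auto)

lemma two_point_inequality:
  fixes p s t :: real
  assumes p: "1 < p" "p \<le> 2"
  shows "2 * (s\<^sup>2 + (p - 1) * t\<^sup>2) powr (p / 2) \<le> \<bar>s + t\<bar> powr p + \<bar>s - t\<bar> powr p"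
proof (cases "\<bar>t\<bar> \<le> \<bar>s\<bar>")
  case False
  \<comment> \<open>Exchanging \<open>s\<close> and \<open>t\<close> preserves the right side and,
    because \<open>p - 1 \<le> 1\<close>, does not decrease the left side.\<close>
  then have "s\<^sup>2 \<le> t\<^sup>2" by (simp add: abs_le_square_iff[symmetric])
  then have "0 \<le> (2 - p) * (t\<^sup>2 - s\<^sup>2)" using p by simp
  then have "s\<^sup>2 + (p - 1) * t\<^sup>2 \<le> t\<^sup>2 + (p - 1) * s\<^sup>2" by (simp add: algebra_simps)
  then have "2 * (s\<^sup>2 + (p - 1) * t\<^sup>2) powr (p / 2) \<le> 2 * (t\<^sup>2 + (p - 1) * s\<^sup>2) powr (p / 2)"
    using p by (intro mult_left_mono powr_mono2) auto
  also have "\<dots> \<le> \<bar>t + s\<bar> powr p + \<bar>t - s\<bar> powr p"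
    using False by (intro two_point_inequality_aux p) auto
  finally show ?thesis by (simp add: add.commute abs_minus_commute)
qed (rule two_point_inequality_aux[OF p])

text \<open>The reverse Minkowski inequality for the exponent \<open>p / 2 \<le> 1\<close> and the
  vectors of squares. Concavity is applied in each coordinate to the normalized squares, with
  weights \<open>A / S\<close> and \<open>c * B / S\<close>.\<close>

lemma powr_half_le_sum:
  fixes a b :: vec
  assumes p: "0 < p" "p \<le> 2" and c: "0 \<le> c"
  shows "((pnorm d p a)\<^sup>2 + c * (pnorm d p b)\<^sup>2) powr (p / 2) \<le> (\<Sum>i<d. ((a i)\<^sup>2 + c * (b i)\<^sup>2) powr (p / 2))"
proof -
  define A where "A = (pnorm d p a)\<^sup>2"
  define B where "B = (pnorm d p b)\<^sup>2"
  define S where "S = A + c * B"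
  have AB: "0 \<le> A" "0 \<le> B" by (auto simp: A_def B_def)
  show ?thesis
  proof (cases "S = 0")
    case True
    then show ?thesis by (simp add: S_def A_def B_def sum_nonneg)
  next
    case False
    then have S: "S > 0" using AB c by (smt (verit) S_def mult_nonneg_nonneg)
    have zero: "x i = 0" if "(pnorm d p x)\<^sup>2 = 0" "i < d" for x i
      using pnorm_eq_0D[OF p(1) _ that(2), of x] that(1) by simp
    have sum1: "(\<Sum>i<d. ((x i)\<^sup>2 / (pnorm d p x)\<^sup>2) powr (p / 2)) = 1" if "(pnorm d p x)\<^sup>2 \<noteq> 0" for x
    proof -
      have pos: "pnorm d p x > 0" using that pnorm_nonneg[of d p x] by (simp add: less_le)
      have "((x i)\<^sup>2 / (pnorm d p x)\<^sup>2) powr (p / 2) = \<bar>x i\<bar> powr p / pnorm d p x powr p" for i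
        by (simp add: powr_divide power2_powr_half)
      then show ?thesis
        using pos p by (simp add: sum_divide_distrib[symmetric] pnorm_powr[OF p(1), symmetric])
    qed
    \<comment> \<open>If \<open>A = 0\<close>, the outer factor \<open>A / S\<close> makes both
      sides vanish, whatever the inner quotients are.\<close>
    have \<alpha>: "A / S * (\<Sum>i<d. ((a i)\<^sup>2 / A) powr (p / 2)) = A / S"
      using sum1[of a] by (cases "A = 0") (auto simp: A_def)
    have \<beta>: "c * B / S * (\<Sum>i<d. ((b i)\<^sup>2 / B) powr (p / 2)) = c * B / S"
      using sum1[of b] by (cases "B = 0") (auto simp: B_def)
    have eq: "(a i)\<^sup>2 + c * (b i)\<^sup>2 = S * (A / S * ((a i)\<^sup>2 / A) + c * B / S * ((b i)\<^sup>2 / B))" if "i < d" for i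
    proof -
      have "A * ((a i)\<^sup>2 / A) = (a i)\<^sup>2" using zero[of a i] that by (cases "A = 0") (auto simp: A_def)
      moreover have "B * ((b i)\<^sup>2 / B) = (b i)\<^sup>2" using zero[of b i] that by (cases "B = 0") (auto simp: B_def)
      moreover have "S * (A / S * ((a i)\<^sup>2 / A) + c * B / S * ((b i)\<^sup>2 / B)) = A * ((a i)\<^sup>2 / A) + c * (B * ((b i)\<^sup>2 / B))"
        using S by (simp add: field_simps)
      ultimately show ?thesis by simp
    qed
    have "S powr (p / 2) = S powr (p / 2) * (A / S * (\<Sum>i<d. ((a i)\<^sup>2 / A) powr (p / 2))
        + c * B / S * (\<Sum>i<d. ((b i)\<^sup>2 / B) powr (p / 2)))"
      using S unfolding \<alpha> \<beta> by (simp add: add_divide_distrib[symmetric] S_def[symmetric])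
    also have "\<dots> = (\<Sum>i<d. S powr (p / 2) * (A / S * ((a i)\<^sup>2 / A) powr (p / 2) + c * B / S * ((b i)\<^sup>2 / B) powr (p / 2)))"
      by (simp only: sum_distrib_left sum.distrib distrib_left)
    also have "\<dots> \<le> (\<Sum>i<d. S powr (p / 2) * (A / S * ((a i)\<^sup>2 / A) + c * B / S * ((b i)\<^sup>2 / B)) powr (p / 2))"
      using S AB c p
      by (intro sum_mono mult_left_mono powr_concave) (auto simp: add_divide_distrib[symmetric] S_def[symmetric])
    also have "\<dots> = (\<Sum>i<d. ((a i)\<^sup>2 + c * (b i)\<^sup>2) powr (p / 2))"
      using S AB c by (intro sum.cong refl) (simp add: eq powr_mult del: times_divide_eq_right)
    finally show ?thesis by (simp add: S_def A_def B_def)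
  qed
qed

text \<open>The Ball--Carlen--Lieb inequality: it gives the modulus \<open>q' - 1\<close> of strong convexity of the
  regularizer.\<close>

lemma pnorm_uniformly_convex:
  assumes p: "1 < p" "p \<le> 2"
  shows "(pnorm d p a)\<^sup>2 + (p - 1) * (pnorm d p b)\<^sup>2 \<le>
    ((pnorm d p (\<lambda>i. a i + b i))\<^sup>2 + (pnorm d p (\<lambda>i. a i - b i))\<^sup>2) / 2"
proof -
  define U where "U = pnorm d p (\<lambda>i. a i + b i)"
  define V where "V = pnorm d p (\<lambda>i. a i - b i)"
  have "((pnorm d p a)\<^sup>2 + (p - 1) * (pnorm d p b)\<^sup>2) powr (p / 2) \<le> (\<Sum>i<d. ((a i)\<^sup>2 + (p - 1) * (b i)\<^sup>2) powr (p / 2))"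
    using p by (intro powr_half_le_sum) auto
  \<comment> \<open>The two-point inequality is the one-dimensional case. Reverse Minkowski before
    it and concavity after it carry it through the sum over the coordinates.\<close>
  also have "\<dots> \<le> (\<Sum>i<d. (\<bar>a i + b i\<bar> powr p + \<bar>a i - b i\<bar> powr p) / 2)"
    using two_point_inequality[OF p] by (intro sum_mono) (simp add: mult.commute)
  also have "\<dots> = (U powr p + V powr p) / 2"
    using p by (simp add: U_def V_def pnorm_powr sum.distrib sum_divide_distrib[symmetric])
  also have "\<dots> = 1/2 * (U\<^sup>2) powr (p / 2) + 1/2 * (V\<^sup>2) powr (p / 2)"
    by (simp add: power2_powr_half U_def V_def)
  also have "\<dots> \<le> (1/2 * U\<^sup>2 + 1/2 * V\<^sup>2) powr (p / 2)"
    using p by (intro powr_concave) auto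
  finally have le: "((pnorm d p a)\<^sup>2 + (p - 1) * (pnorm d p b)\<^sup>2) powr (p / 2) \<le> (1/2 * U\<^sup>2 + 1/2 * V\<^sup>2) powr (p / 2)" .
  show ?thesis
  proof (rule ccontr)
    assume "\<not> ?thesis"
    then have "1/2 * U\<^sup>2 + 1/2 * V\<^sup>2 < (pnorm d p a)\<^sup>2 + (p - 1) * (pnorm d p b)\<^sup>2"
      by (simp add: U_def V_def)
    then have "(1/2 * U\<^sup>2 + 1/2 * V\<^sup>2) powr (p / 2) < ((pnorm d p a)\<^sup>2 + (p - 1) * (pnorm d p b)\<^sup>2) powr (p / 2)"
      using p by (intro powr_less_mono2) auto
    then show False using le by simp
  qed
qed

section \<open>Convex functions on open sets\<close>

lemma dot_cvx_comb: "dot d g (vdiff (cvx_comb t x y) x) = t * dot d g (vdiff y x)"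
  by (simp add: dot_def vdiff_def cvx_comb_def sum_distrib_left algebra_simps)

text \<open>Openness is exploited along coordinate lines only: such a line is a continuous image of
  the reals, so the preimage of \<open>B\<close> contains an interval.\<close>

lemma openin_Euclidean_space_line:
  assumes "openin (Euclidean_space d) B" "v \<in> B" "i < d"
  obtains r where "r > 0" "\<And>t. \<bar>t - v i\<bar> < r \<Longrightarrow> v(i := t) \<in> B"
proof -
  have v: "v \<in> Rn d" using openin_subset[OF assms(1)] assms(2) by blast
  have "continuous_map euclideanreal (Euclidean_space d) (\<lambda>t. v(i := t))"
    unfolding Euclidean_space_def continuous_map_in_subtopology
    using v assms(3) by (auto simp: continuous_map_componentwise_UNIV topspace_Euclidean_space fun_upd_def)
  then have "openin euclideanreal {t \<in> topspace euclideanreal. v(i := t) \<in> B}"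
    using assms(1) by (rule openin_continuous_map_preimage)
  then have "open {t. v(i := t) \<in> B}" by simp
  moreover have "v i \<in> {t. v(i := t) \<in> B}" using assms(2) by simp
  ultimately obtain r where "r > 0" "ball (v i) r \<subseteq> {t. v(i := t) \<in> B}"
    using open_contains_ball by blast
  then show ?thesis
    by (intro that[of r]) (auto simp: dist_real_def abs_minus_commute subset_iff)
qed

text \<open>A countable test set, on which almost sure inequalities hold simultaneously. On
  \<open>Rn d\<close> the coordinates from index \<open>d\<close> on are 0 and hence
  rational.\<close>

definition rational_points :: "vec set \<Rightarrow> vec set" where
  "rational_points B = {v \<in> B. \<forall>i. v i \<in> \<rat>}"

lemma countable_rational_points:
  assumes "B \<subseteq> Rn d"
  shows "countable (rational_points B)"
proof (rule countable_subset)
  show "rational_points B \<subseteq> (\<lambda>l i. if i < d then l ! i else 0) ` lists \<rat>"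
  proof
    fix v assume "v \<in> rational_points B"
    then have "v = (\<lambda>i. if i < d then map v [0..<d] ! i else 0)" "map v [0..<d] \<in> lists \<rat>"
      using assms by (auto simp: rational_points_def topspace_Euclidean_space fun_eq_iff)
    then show "v \<in> (\<lambda>l i. if i < d then l ! i else 0) ` lists \<rat>" by blast
  qed
  show "countable ((\<lambda>l i. if i < d then l ! i else 0) ` lists (\<rat> :: real set))"
    by (intro countable_image countable_lists countable_rat)
qed

text \<open>A convex function that is negative somewhere stays negative while the coordinates are moved,
  one after the other, to nearby rationals; only one-dimensional convexity is needed.\<close>

lemma vconvex_on_negative_rational:
  assumes B: "openin (Euclidean_space d) B" and h: "vconvex_on B h"
    and y: "y \<in> B" "h y < 0"
  shows "\<exists>v\<in>rational_points B. h v < 0"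
proof -
  have step: "\<exists>v\<in>B. h v < 0 \<and> (\<forall>i<k. v i \<in> \<rat>)" if "k \<le> d" for k
    using that
  proof (induction k)
    case 0
    then show ?case using y by auto
  next
    case (Suc k)
    then obtain v where v: "v \<in> B" "h v < 0" "\<forall>i<k. v i \<in> \<rat>" by auto
    obtain r where r: "r > 0" "\<And>t. \<bar>t - v k\<bar> < r \<Longrightarrow> v(k := t) \<in> B"
      using openin_Euclidean_space_line[OF B v(1), of k] Suc.prems by auto
    define w where "w = v(k := v k + r / 2)"
    have w: "w \<in> B" unfolding w_def using r by (intro r(2)) auto
    \<comment> \<open>\<open>\<tau>\<close> bounds the fraction of the segment from \<open>v\<close>
      to \<open>w\<close> on which the convexity bound for \<open>h\<close> stays negative; a
      rational value of coordinate \<open>k\<close> is then chosen within that part.\<close>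
    obtain \<tau> :: real where \<tau>: "0 < \<tau>" "\<tau> < 1" "\<tau> * (\<bar>h w\<bar> + \<bar>h v\<bar>) < - h v"
    proof
      define D where "D = \<bar>h w\<bar> + \<bar>h v\<bar>"
      have D: "D > 0" "- h v \<le> D" using v by (auto simp: D_def)
      show "0 < - h v / (2 * D)" "- h v / (2 * D) < 1" "- h v / (2 * D) * (\<bar>h w\<bar> + \<bar>h v\<bar>) < - h v"
        using D v unfolding D_def by (auto simp: divide_simps)
    qed
    obtain s where s: "s \<in> \<rat>" "v k < s" "s < v k + \<tau> * r / 2"
      using Rats_dense_in_real[of "v k" "v k + \<tau> * r / 2"] \<tau> r by auto
    define t where "t = (s - v k) / (r / 2)"
    have t: "0 < t" "t < \<tau>" using s r by (auto simp: t_def field_simps)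
    have s_eq: "s = v k + t * (r / 2)" using r by (simp add: t_def field_simps)
    define v' where "v' = v(k := s)"
    have v'_eq: "v' = cvx_comb t v w"
      by (auto simp: v'_def w_def cvx_comb_def fun_eq_iff s_eq algebra_simps)
    have "v' \<in> B" using h v w t \<tau> unfolding v'_eq vconvex_on_def vconvex_def by auto
    moreover have "h v' < 0"
    proof -
      have "h v' \<le> (1 - t) * h v + t * h w"
        using h v w t \<tau> unfolding v'_eq vconvex_on_def by auto
      also have "\<dots> = h v + t * (h w - h v)" by (simp add: algebra_simps)
      also have "\<dots> \<le> h v + t * (\<bar>h w\<bar> + \<bar>h v\<bar>)"
        using t by (intro add_left_mono mult_left_mono) auto
      also have "\<dots> \<le> h v + \<tau> * (\<bar>h w\<bar> + \<bar>h v\<bar>)"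
        using t \<tau> by (intro add_left_mono mult_right_mono) auto
      also have "\<dots> < 0" using \<tau> by simp
      finally show ?thesis .
    qed
    moreover have "\<forall>i<Suc k. v' i \<in> \<rat>" using v(3) s(1) by (auto simp: v'_def less_Suc_eq)
    ultimately show ?case by blast
  qed
  then obtain v where v: "v \<in> B" "h v < 0" "\<forall>i<d. v i \<in> \<rat>" by auto
  have "v i \<in> \<rat>" for i
    using v openin_subset[OF B] by (cases "i < d") (auto simp: topspace_Euclidean_space)
  then show ?thesis using v by (auto simp: rational_points_def)
qed

text \<open>Subtracting the affine function leaves a convex function; were it negative at
  \<open>y\<close>, it would be negative at a rational point too.\<close>

lemma subgradient_from_rational_points:
  assumes B: "openin (Euclidean_space d) B" and h: "vconvex_on B h"
    and ineq: "\<And>v. v \<in> rational_points B \<Longrightarrow> c + dot d g (vdiff v x) \<le> h v"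
    and y: "y \<in> B"
  shows "c + dot d g (vdiff y x) \<le> h y"
proof (rule ccontr)
  assume "\<not> ?thesis"
  then have neg: "h y - (c + dot d g (vdiff y x)) < 0" by simp
  have "vconvex_on B (\<lambda>v. h v - (c + dot d g (vdiff v x)))"
    unfolding vconvex_on_def
  proof (intro conjI ballI)
    show "vconvex B" using h by (simp add: vconvex_on_def)
    fix u v and t :: real assume uv: "u \<in> B" "v \<in> B" "t \<in> {0..1}"
    have "dot d g (vdiff (cvx_comb t u v) x) = (1 - t) * dot d g (vdiff u x) + t * dot d g (vdiff v x)"
      by (simp add: dot_def vdiff_def cvx_comb_def sum_distrib_left sum.distrib[symmetric] algebra_simps)
    moreover have "h (cvx_comb t u v) \<le> (1 - t) * h u + t * h v"
      using h uv by (auto simp: vconvex_on_def)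
    ultimately show "h (cvx_comb t u v) - (c + dot d g (vdiff (cvx_comb t u v) x))
        \<le> (1 - t) * (h u - (c + dot d g (vdiff u x))) + t * (h v - (c + dot d g (vdiff v x)))"
      by (simp add: algebra_simps)
  qed
  from vconvex_on_negative_rational[OF B this y neg] show False using ineq by force
qed

section \<open>Samples and their laws\<close>

lemma borel_measurable_vec_component [measurable]: "(\<lambda>x::vec. x i) \<in> borel_measurable borel"
  by (intro borel_measurable_continuous_onI continuous_on_product_coordinates)

lemma borel_on_component [measurable]: "(\<lambda>x. x i) \<in> borel_measurable (borel_on S)"
  by (intro measurable_restrict_space1) measurable

lemma borel_measurable_pnorm [measurable (raw)]:
  assumes [measurable]: "\<And>i. (\<lambda>w. h w i) \<in> borel_measurable N"
  shows "(\<lambda>w. pnorm d p (h w)) \<in> borel_measurable N"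
  unfolding pnorm_def by measurable

lemma borel_measurable_dot [measurable (raw)]:
  assumes [measurable]: "\<And>i. (\<lambda>w. g w i) \<in> borel_measurable N" "\<And>i. (\<lambda>w. h w i) \<in> borel_measurable N"
  shows "(\<lambda>w. dot d (g w) (h w)) \<in> borel_measurable N"
  unfolding dot_def by measurable

lemma borel_measurable_vdiff [measurable (raw)]:
  assumes [measurable]: "(\<lambda>w. g w i) \<in> borel_measurable N" "(\<lambda>w. h w i) \<in> borel_measurable N"
  shows "(\<lambda>w. vdiff (g w) (h w) i) \<in> borel_measurable N"
  unfolding vdiff_def by measurable

lemma borel_on_component_compose [measurable (raw)]:
  assumes "h \<in> measurable N (borel_on S)"
  shows "(\<lambda>w. h w i) \<in> borel_measurable N"
  using measurable_compose[OF assms borel_on_component] .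

section \<open>Exchange of a sample entry with an independent draw\<close>

definition swap_sample :: "nat \<Rightarrow> (nat \<Rightarrow> 'a) \<times> 'a \<Rightarrow> (nat \<Rightarrow> 'a) \<times> 'a" where
  "swap_sample j = (\<lambda>(s, z). (s(j := z), s j))"

lemma measurable_swap_sample:
  assumes "j \<in> I"
  shows "swap_sample j \<in> measurable (PiM I (\<lambda>_. P) \<Otimes>\<^sub>M P) (PiM I (\<lambda>_. P) \<Otimes>\<^sub>M P)"
proof -
  have "insert j I = I" using assms by auto
  moreover have "(\<lambda>w. (fst w)(j := snd w)) \<in> measurable (PiM I (\<lambda>_. P) \<Otimes>\<^sub>M P) (PiM (insert j I) (\<lambda>_. P))"
    by (intro measurable_fun_upd[where J=I]) (use \<open>insert j I = I\<close> in auto)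
  ultimately show ?thesis
    unfolding swap_sample_def split_beta' using assms by (intro measurable_Pair) auto
qed

text \<open>With entry \<open>j\<close> split off, the joint law is an iterated integral over the
  remaining entries, entry \<open>j\<close> and the copy. The exchange interchanges the last two
  integrations, which Fubini's theorem permits.\<close>

lemma distr_swap_sample:
  assumes P: "prob_space P" and j: "j \<in> I" and I: "finite I"
  shows "distr (PiM I (\<lambda>_. P) \<Otimes>\<^sub>M P) (PiM I (\<lambda>_. P) \<Otimes>\<^sub>M P) (swap_sample j) = PiM I (\<lambda>_. P) \<Otimes>\<^sub>M P"
    (is "distr ?Q ?Q _ = ?Q")
proof (rule measure_eqI)
  interpret P: prob_space P by fact
  interpret PP: product_sigma_finite "\<lambda>_. P" by standard
  interpret Pi: prob_space "PiM I (\<lambda>_. P)" by (intro prob_space_PiM P)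
  note [measurable] = measurable_swap_sample[OF j]
  define K where "K = I - {j}"
  have K: "finite K" "j \<notin> K" "insert j K = I" using I j by (auto simp: K_def)
  interpret PK: prob_space "PiM K (\<lambda>_. P)" by (intro prob_space_PiM P)
  fix A assume "A \<in> sets (distr ?Q ?Q (swap_sample j))"
  then have A[measurable]: "A \<in> sets ?Q" by simp
  define h :: "_ \<Rightarrow> ennreal" where "h = indicator A"
  have h[measurable]: "h \<in> borel_measurable ?Q" unfolding h_def by measurable
  have upd[measurable]: "(\<lambda>w. (fst w)(j := snd w)) \<in> measurable (PiM K (\<lambda>_. P) \<Otimes>\<^sub>M P) (PiM I (\<lambda>_. P))"
    by (intro measurable_fun_upd[where J=K]) (use K in auto)
  have *: "(\<integral>\<^sup>+w. g w \<partial>?Q) = (\<integral>\<^sup>+r. (\<integral>\<^sup>+y. (\<integral>\<^sup>+z. g (r(j := y), z) \<partial>P) \<partial>P) \<partial>PiM K (\<lambda>_. P))"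
    if [measurable]: "g \<in> borel_measurable ?Q" for g
  proof -
    have "(\<integral>\<^sup>+w. g w \<partial>?Q) = (\<integral>\<^sup>+s. (\<integral>\<^sup>+z. g (s, z) \<partial>P) \<partial>PiM I (\<lambda>_. P))"
      by (simp add: P.nn_integral_fst)
    also have "\<dots> = (\<integral>\<^sup>+r. (\<integral>\<^sup>+y. (\<integral>\<^sup>+z. g (r(j := y), z) \<partial>P) \<partial>P) \<partial>PiM K (\<lambda>_. P))"
      using PP.product_nn_integral_insert[OF K(1,2), of "\<lambda>s. \<integral>\<^sup>+z. g (s, z) \<partial>P"] unfolding K(3) by simp
    finally show ?thesis .
  qed
  have "emeasure (distr ?Q ?Q (swap_sample j)) A = (\<integral>\<^sup>+w. h (swap_sample j w) \<partial>?Q)"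
  proof -
    have "emeasure (distr ?Q ?Q (swap_sample j)) A = (\<integral>\<^sup>+w. h w \<partial>distr ?Q ?Q (swap_sample j))"
      by (simp add: h_def)
    then show ?thesis by (simp add: nn_integral_distr h measurable_swap_sample[OF j])
  qed
  also have "\<dots> = (\<integral>\<^sup>+r. (\<integral>\<^sup>+y. (\<integral>\<^sup>+z. h (r(j := z), y) \<partial>P) \<partial>P) \<partial>PiM K (\<lambda>_. P))"
    using *[OF measurable_compose[OF measurable_swap_sample[OF j] h]] by (simp add: swap_sample_def)
  also have "\<dots> = (\<integral>\<^sup>+r. (\<integral>\<^sup>+z. (\<integral>\<^sup>+y. h (r(j := z), y) \<partial>P) \<partial>P) \<partial>PiM K (\<lambda>_. P))"
  proof (rule nn_integral_cong)
    fix r assume r[measurable]: "r \<in> space (PiM K (\<lambda>_. P))"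
    have m: "(\<lambda>w. h (r(j := fst w), snd w)) \<in> borel_measurable (P \<Otimes>\<^sub>M P)"
    proof -
      have "(\<lambda>w. r(j := fst w)) \<in> measurable (P \<Otimes>\<^sub>M P) (PiM I (\<lambda>_. P))"
        by (intro measurable_fun_upd[where J=K]) (use K r in auto)
      then show ?thesis by measurable
    qed
    interpret pair_sigma_finite P P by standard
    show "(\<integral>\<^sup>+y. (\<integral>\<^sup>+z. h (r(j := z), y) \<partial>P) \<partial>P) = (\<integral>\<^sup>+z. (\<integral>\<^sup>+y. h (r(j := z), y) \<partial>P) \<partial>P)"
      using m by (intro Fubini') (simp add: split_beta')
  qed
  also have "\<dots> = (\<integral>\<^sup>+w. h w \<partial>?Q)"
    by (rule *[OF h, symmetric])
  also have "\<dots> = emeasure ?Q A" by (simp add: h_def)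
  finally show "emeasure (distr ?Q ?Q (swap_sample j)) A = emeasure ?Q A" .
qed simp

text \<open>Preimages of null sets of the law are null, hence measurable in the complete space
  \<open>M\<close>. This gives access to functions such as the sections of \<open>G\<close>, which
  are measurable only for the completed law, and makes their integrals depend on the law
  alone.\<close>

lemma distr_completion_complete:
  assumes M: "complete_measure M" and X: "X \<in> measurable M N"
  shows "X \<in> measurable M (completion (distr M N X))"
    and "distr M (completion (distr M N X)) X = completion (distr M N X)"
proof -
  interpret complete_measure M by fact
  have eq: "distr M (distr M N X) X = distr M N X"
    by (rule measure_eqI) (use X in \<open>auto simp: emeasure_distr\<close>)
  show "X \<in> measurable M (completion (distr M N X))"
    using X by (intro measurable_completion2) (auto simp: eq)
  show "distr M (completion (distr M N X)) X = completion (distr M N X)"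
    using completion_distr_eq[of X "distr M N X"] X by (simp add: eq)
qed

lemma integrable_complete_iff:
  fixes u :: "'b \<Rightarrow> real"
  assumes M: "complete_measure M" and X: "X \<in> measurable M N"
    and u: "u \<in> borel_measurable (completion (distr M N X))"
  shows "integrable M (\<lambda>w. u (X w)) \<longleftrightarrow> integrable (completion (distr M N X)) u"
    and "(\<integral>w. u (X w) \<partial>M) = (\<integral>x. u x \<partial>completion (distr M N X))"
  using distr_completion_complete[OF M X] u
    integrable_distr_eq[of X M "completion (distr M N X)" u] integral_distr[of X M "completion (distr M N X)" u]
  by auto

lemma nn_integral_complete:
  assumes M: "complete_measure M" and X: "X \<in> measurable M N"
    and u: "u \<in> borel_measurable (completion (distr M N X))"
  shows "(\<integral>\<^sup>+w. u (X w) \<partial>M) = (\<integral>\<^sup>+x. u x \<partial>completion (distr M N X))"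
  using distr_completion_complete[OF M X] u
    nn_integral_distr[of X M "completion (distr M N X)" u]
  by auto

lemma sample_vector_law:
  assumes M: "prob_space M" and X: "\<xi> \<in> measurable M (borel_on \<Xi>)"
    and N: "N \<ge> 1" and iid: "iid_sample M \<Xi> \<xi> N \<xi>s"
  shows "sample_vector N \<xi>s \<in> measurable M (\<Pi>\<^sub>M j\<in>{1..N}. distr M (borel_on \<Xi>) \<xi>)"
    and "distr M (\<Pi>\<^sub>M j\<in>{1..N}. distr M (borel_on \<Xi>) \<xi>) (sample_vector N \<xi>s)
      = (\<Pi>\<^sub>M j\<in>{1..N}. distr M (borel_on \<Xi>) \<xi>)"
proof -
  interpret prob_space M by fact
  have ind: "indep_vars (\<lambda>_. borel_on \<Xi>) \<xi>s {1..N}"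
    and law: "\<And>j. j \<in> {1..N} \<Longrightarrow> distr M (borel_on \<Xi>) (\<xi>s j) = distr M (borel_on \<Xi>) \<xi>"
    using iid by (auto simp: iid_sample_def)
  have rv: "\<xi>s j \<in> measurable M (borel_on \<Xi>)" if "j \<in> {1..N}" for j
    using ind that by (auto simp: indep_vars_def)
  have sv: "sample_vector N \<xi>s = (\<lambda>\<omega>. \<lambda>j\<in>{1..N}. \<xi>s j \<omega>)"
    by (simp add: sample_vector_def fun_eq_iff)
  have s: "sets (\<Pi>\<^sub>M j\<in>{1..N}. distr M (borel_on \<Xi>) \<xi>) = sets (\<Pi>\<^sub>M j\<in>{1..N}. borel_on \<Xi>)"
    by (intro sets_PiM_cong) auto
  show "sample_vector N \<xi>s \<in> measurable M (\<Pi>\<^sub>M j\<in>{1..N}. distr M (borel_on \<Xi>) \<xi>)"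
    unfolding sv by (intro measurable_restrict) (use rv in auto)
  have "distr M (\<Pi>\<^sub>M j\<in>{1..N}. distr M (borel_on \<Xi>) \<xi>) (sample_vector N \<xi>s)
      = distr M (\<Pi>\<^sub>M j\<in>{1..N}. borel_on \<Xi>) (sample_vector N \<xi>s)"
    by (intro distr_cong) (use s in auto)
  also have "\<dots> = (\<Pi>\<^sub>M j\<in>{1..N}. distr M (borel_on \<Xi>) (\<xi>s j))"
    \<comment> \<open>Independence is characterized by the product law for nonempty index sets,
      whence \<open>N \<ge> 1\<close>.\<close>
    using ind N unfolding sv by (subst (asm) indep_vars_iff_distr_eq_PiM') (use rv in auto)
  also have "\<dots> = (\<Pi>\<^sub>M j\<in>{1..N}. distr M (borel_on \<Xi>) \<xi>)"
    by (intro PiM_cong) (use law in auto)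
  finally show "distr M (\<Pi>\<^sub>M j\<in>{1..N}. distr M (borel_on \<Xi>) \<xi>) (sample_vector N \<xi>s)
      = (\<Pi>\<^sub>M j\<in>{1..N}. distr M (borel_on \<Xi>) \<xi>)" .
qed

section \<open>Stability of the regularized problem\<close>

text \<open>Measurability is a separate conjunct because integrability of the square does not imply
  it.\<close>

definition square_integrable :: "'a measure \<Rightarrow> ('a \<Rightarrow> real) \<Rightarrow> bool" where
  "square_integrable M h \<longleftrightarrow> h \<in> borel_measurable M \<and> integrable M (\<lambda>x. (h x)\<^sup>2)"

lemma square_integrable_mult:
  assumes "square_integrable M g" "square_integrable M h"
  shows "integrable M (\<lambda>x. g x * h x)"
proof (rule Bochner_Integration.integrable_bound)
  show "integrable M (\<lambda>x. (g x)\<^sup>2 + (h x)\<^sup>2)"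
    using assms by (auto simp: square_integrable_def)
  show "AE x in M. norm (g x * h x) \<le> norm ((g x)\<^sup>2 + (h x)\<^sup>2)"
  proof (rule AE_I2)
    fix x
    have "0 \<le> (\<bar>g x\<bar> - \<bar>h x\<bar>)\<^sup>2" by simp
    then have "2 * \<bar>g x * h x\<bar> \<le> (g x)\<^sup>2 + (h x)\<^sup>2" by (simp add: power2_diff abs_mult)
    then show "norm (g x * h x) \<le> norm ((g x)\<^sup>2 + (h x)\<^sup>2)" by simp
  qed
qed (use assms in \<open>auto simp: square_integrable_def\<close>)

lemma square_integrable_add:
  assumes "square_integrable M g" "square_integrable M h"
  shows "square_integrable M (\<lambda>x. g x + h x)"
  using square_integrable_mult[OF assms] assms
  by (auto simp: square_integrable_def power2_sum mult.assoc)

lemma square_integrable_const [simp]: "finite_measure M \<Longrightarrow> square_integrable M (\<lambda>_. c)"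
  by (simp add: square_integrable_def finite_measure.integrable_const)

lemma square_integrable_divide:
  "square_integrable M h \<Longrightarrow> square_integrable M (\<lambda>x. h x / c)"
  by (auto simp: square_integrable_def power_divide)

lemma square_integrable_sum:
  assumes "finite_measure M" "\<And>i. i \<in> I \<Longrightarrow> square_integrable M (h i)"
  shows "square_integrable M (\<lambda>x. \<Sum>i\<in>I. h i x)"
  using assms(2) by (induction I rule: infinite_finite_induct)
    (auto intro: square_integrable_add simp: assms(1))

lemma square_integrable_imp_integrable:
  assumes "finite_measure M" "square_integrable M h"
  shows "integrable M h"
  using square_integrable_mult[OF assms(2) square_integrable_const[OF assms(1), of 1]] by simp

lemma square_integrable_compose:
  assumes "T \<in> measurable M N" "distr M N T = N" "square_integrable N h"
  shows "square_integrable M (\<lambda>x. h (T x))"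
    and "(\<integral>x. (h (T x))\<^sup>2 \<partial>M) = (\<integral>x. (h x)\<^sup>2 \<partial>N)"
proof -
  have [measurable]: "h \<in> borel_measurable N" using assms(3) by (simp add: square_integrable_def)
  note [measurable] = assms(1)
  show "square_integrable M (\<lambda>x. h (T x))"
    using assms(3) integrable_distr[of T M N "\<lambda>x. (h x)\<^sup>2"] assms(2)
    by (auto simp: square_integrable_def)
  show "(\<integral>x. (h (T x))\<^sup>2 \<partial>M) = (\<integral>x. (h x)\<^sup>2 \<partial>N)"
    using integral_distr[of T M N "\<lambda>x. (h x)\<^sup>2"] assms(2) by simp
qed

lemma square_integrable_nn_integral:
  assumes [measurable]: "h \<in> borel_measurable M" and "(\<integral>\<^sup>+x. ennreal ((h x)\<^sup>2) \<partial>M) \<le> ennreal c" "0 \<le> c"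
  shows "square_integrable M h" "(\<integral>x. (h x)\<^sup>2 \<partial>M) \<le> c"
proof -
  have "(\<integral>\<^sup>+x. ennreal ((h x)\<^sup>2) \<partial>M) < \<infinity>" using assms(2) by (simp add: order_le_less_trans)
  then have i: "integrable M (\<lambda>x. (h x)\<^sup>2)" by (intro integrableI_nonneg) auto
  then show "square_integrable M h" by (simp add: square_integrable_def)
  show "(\<integral>x. (h x)\<^sup>2 \<partial>M) \<le> c"
    using nn_integral_eq_integral[OF i] assms(2,3) by simp
qed

text \<open>The stability estimate: with \<open>D\<close> the distance between the approximate solutions for two
  samples differing in one entry, the first hypothesis is strong convexity and the second one the
  subgradient inequality, where \<open>A\<close> collects the four values of \<open>f\<close> involved.\<close>

lemma stability_bound:
  fixes A D K L V :: real
  assumes "0 \<le> D" "0 < K" "L \<le> K" "0 \<le> V"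
    and 1: "2 * K * D\<^sup>2 \<le> 2 * D + A" and 2: "A \<le> L * D\<^sup>2 + V * D"
  shows "A \<le> 2 * (2 + V)\<^sup>2 / K"
proof -
  \<comment> \<open>In the application \<open>K = \<kappa> * real N\<close>. Half of the strong
    convexity term absorbs \<open>L * D\<^sup>2\<close>, the other half bounds
    \<open>D\<close>.\<close>
  have LK: "L * D\<^sup>2 \<le> K * D\<^sup>2" using assms by (intro mult_right_mono) auto
  have "K * D * D \<le> (2 + V) * D" using 1 2 LK by (simp add: algebra_simps power2_eq_square)
  then have KD: "K * D \<le> 2 + V" using assms by (cases "D = 0") (auto simp: mult_le_cancel_right)
  then have D: "D \<le> (2 + V) / K" using assms by (simp add: field_simps)
  have "A \<le> (K * D + V) * D" using 2 LK by (simp add: algebra_simps power2_eq_square)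
  also have "\<dots> \<le> 2 * (2 + V) * ((2 + V) / K)"
    using KD D assms by (intro mult_mono) auto
  finally show ?thesis by (simp add: power2_eq_square algebra_simps add_divide_distrib)
qed

text \<open>The squared differences of all pairs sum exactly to the gap between the two
  sides.\<close>

lemma power2_sum4_le: "(a + b + c + e)\<^sup>2 \<le> 4 * (a\<^sup>2 + b\<^sup>2 + c\<^sup>2 + e\<^sup>2)" for a b c e :: real
proof -
  have "0 \<le> (a - b)\<^sup>2 + (a - c)\<^sup>2 + (a - e)\<^sup>2 + (b - c)\<^sup>2 + (b - e)\<^sup>2 + (c - e)\<^sup>2" by simp
  then show ?thesis by (simp add: power2_eq_square algebra_simps)
qed

text \<open>The stochastic subgradients enter only through the hypotheses \<open>sub\<close> and \<open>sub_xs\<close>: the mean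
  subgradient \<open>g x\<close> satisfies the subgradient inequality of \<open>f\<close> up to a noise term \<open>e\<close> with
  second moment at most \<open>\<sigma>\<^sup>2\<close>. The noise at the comparison point \<open>xs\<close> is needed for integrability
  only.\<close>

locale saa_stability = P: prob_space P for P :: "vec measure" +
  fixes d N :: nat and X :: "vec set" and f :: "vec \<Rightarrow> vec \<Rightarrow> real"
    and F V :: "vec \<Rightarrow> real" and g :: "vec \<Rightarrow> vec" and xt :: "(nat \<Rightarrow> vec) \<Rightarrow> vec"
    and e :: "(nat \<Rightarrow> vec) \<times> vec \<Rightarrow> real" and es :: "vec \<Rightarrow> real" and xs :: vec
    and q \<delta> \<kappa> lam L M c \<sigma> :: real
  assumes N: "N \<ge> 1"
    and F_def: "\<And>x. F x = (\<integral>z. f x z \<partial>P)"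
    and f_measurable: "(\<lambda>(x, z). f x z) \<in> borel_measurable (borel_on X \<Otimes>\<^sub>M P)"
    and f_integrable: "\<And>x. x \<in> X \<Longrightarrow> integrable P (f x)"
    and V_measurable: "V \<in> borel_measurable (borel_on X)" and V_nonneg: "\<And>x. 0 \<le> V x"
    and xt_measurable: "xt \<in> measurable (PiM {1..N} (\<lambda>_. P)) (borel_on X)"
    and params: "0 \<le> \<delta>" "\<delta> \<le> 1 / real N" "0 < \<kappa>" "0 < lam" "0 \<le> L" "L \<le> \<kappa> * real N" "1 \<le> M" "0 \<le> c"
    \<comment> \<open>Strong convexity is already built into approximate optimality; in the
      application \<open>\<kappa> = lam * (q' - 1) / 4\<close>.\<close>
    and approx: "AE s in PiM {1..N} (\<lambda>_. P). \<forall>y\<in>X.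
      (\<Sum>j=1..N. f (xt s) (s j)) / real N + lam * V (xt s) - \<delta> * pnorm d q (vdiff y (xt s))
        + \<kappa> * (pnorm d q (vdiff y (xt s)))\<^sup>2 \<le> (\<Sum>j=1..N. f y (s j)) / real N + lam * V y"
    and e_measurable: "e \<in> borel_measurable (PiM {1..N} (\<lambda>_. P) \<Otimes>\<^sub>M P)"
    and e_nonneg: "\<And>w. 0 \<le> e w"
    and e_square: "(\<integral>\<^sup>+w. ennreal ((e w)\<^sup>2) \<partial>(PiM {1..N} (\<lambda>_. P) \<Otimes>\<^sub>M P)) \<le> ennreal (\<sigma>\<^sup>2)"
    and sub: "AE w in PiM {1..N} (\<lambda>_. P) \<Otimes>\<^sub>M P. \<forall>y\<in>X.
      f (xt (fst w)) (snd w) + dot d (g (xt (fst w))) (vdiff y (xt (fst w)))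
        - e w * pnorm d q (vdiff y (xt (fst w))) \<le> f y (snd w)"
    and es_square: "square_integrable P es"
    and sub_xs: "AE z in P. \<forall>y\<in>X. f xs z - (c + es z) * pnorm d q (vdiff y xs) \<le> f y z"
    and xs: "xs \<in> X" "\<And>x. x \<in> X \<Longrightarrow> F xs \<le> F x"
    \<comment> \<open>The \<open>L\<close> term comes from the Lipschitz gradient of
      \<open>F\<^sub>1\<close>, the \<open>2 * M\<close> from the bounded residuals at the two
      points.\<close>
    and g_mono: "\<And>x y. x \<in> X \<Longrightarrow> y \<in> X \<Longrightarrow> dot d (vdiff (g x) (g y)) (vdiff x y)
      \<le> L * (pnorm d q (vdiff x y))\<^sup>2 + 2 * M * pnorm d q (vdiff x y)"
    \<comment> \<open>\<open>c\<close> stems from the mean subgradient at \<open>xs\<close> and may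
      be arbitrarily large: it makes expectations finite without entering the final
      estimate.\<close>
    and F_growth: "\<And>x. x \<in> X \<Longrightarrow> F x - F xs
      \<le> L * (pnorm d q (vdiff x xs))\<^sup>2 + (2 * M + c) * pnorm d q (vdiff x xs)"
begin

declare One_nat_def [simp del]

abbreviation "SP \<equiv> PiM {1..N} (\<lambda>_. P)"
abbreviation "Q \<equiv> SP \<Otimes>\<^sub>M P"

sublocale SP: prob_space SP by (intro prob_space_PiM P.prob_space_axioms)
sublocale Q: pair_prob_space SP P ..

lemma space_borel_on_X: "space (borel_on X) = X"
  by (simp add: space_restrict_space)

lemma xt_in_X: "s \<in> space SP \<Longrightarrow> xt s \<in> X"
  using measurable_space[OF xt_measurable] space_borel_on_X by auto

lemma AE_xt_in_X: "AE s in SP. xt s \<in> X"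
  using xt_in_X by (intro AE_I2)

lemma F_measurable: "F \<in> borel_measurable (borel_on X)"
  using P.borel_measurable_lebesgue_integral[OF f_measurable] by (simp add: F_def[abs_def])

lemmas [measurable] = xt_measurable V_measurable F_measurable e_measurable

section \<open>Projections and exchanges as measure-preserving maps\<close>

lemma SP_component:
  assumes "j \<in> {1..N}"
  shows "(\<lambda>s. s j) \<in> measurable SP P" "distr SP P (\<lambda>s. s j) = P"
  using assms distr_PiM_component[of "{1..N}" "\<lambda>_. P" j] P.prob_space_axioms by auto

lemma AE_component:
  assumes "j \<in> {1..N}" "AE z in P. R z"
  shows "AE s in SP. R (s j)"
  by (rule AE_distrD[OF SP_component(1)[OF assms(1)]]) (simp only: SP_component(2)[OF assms(1)] assms(2))

lemma AE_components:
  assumes "AE z in P. R z"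
  shows "AE s in SP. \<forall>j\<in>{1..N}. R (s j)"
  by (intro AE_finite_allI) (auto intro: AE_component assms)

lemma integrable_component:
  assumes "j \<in> {1..N}" "integrable P (h :: vec \<Rightarrow> real)"
  shows "integrable SP (\<lambda>s. h (s j))" "(\<integral>s. h (s j) \<partial>SP) = (\<integral>z. h z \<partial>P)"
  using integrable_distr[OF SP_component(1)[OF assms(1)], of h] SP_component[OF assms(1)] assms(2)
    integral_distr[OF SP_component(1)[OF assms(1)], of h]
  by auto

lemma AE_SP_Q:
  assumes "AE s in SP. R s"
  shows "AE w in Q. R (fst w)"
  by (rule AE_distrD[OF measurable_fst]) (simp only: P.distr_pair_fst assms)

lemma integrable_fst:
  assumes "integrable SP (h :: (nat \<Rightarrow> vec) \<Rightarrow> real)"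
  shows "integrable Q (\<lambda>w. h (fst w))" "(\<integral>w. h (fst w) \<partial>Q) = (\<integral>s. h s \<partial>SP)"
  using integrable_distr[of fst Q SP h] integral_distr[of fst Q SP h] assms
  by (auto simp: P.distr_pair_fst)

lemma swap:
  assumes "j \<in> {1..N}"
  shows "swap_sample j \<in> measurable Q Q" "distr Q Q (swap_sample j) = Q"
  by (rule measurable_swap_sample[OF assms], rule distr_swap_sample[OF P.prob_space_axioms assms], simp)

lemma AE_swap:
  assumes "j \<in> {1..N}" "AE w in Q. R w"
  shows "AE w in Q. R (swap_sample j w)"
  by (rule AE_distrD[OF swap(1)[OF assms(1)]]) (simp only: swap(2)[OF assms(1)] assms(2))

lemma integrable_swap:
  assumes "j \<in> {1..N}" "integrable Q (h :: _ \<Rightarrow> real)"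
  shows "integrable Q (\<lambda>w. h (swap_sample j w))" "(\<integral>w. h (swap_sample j w) \<partial>Q) = (\<integral>w. h w \<partial>Q)"
  using integrable_distr[OF swap(1)[OF assms(1)], of h] swap[OF assms(1)] assms(2)
    integral_distr[OF swap(1)[OF assms(1)], of h]
  by auto

lemma f_xt_measurable:
  "(\<lambda>w. f (xt (fst w)) (snd w)) \<in> borel_measurable Q"
  "j \<in> {1..N} \<Longrightarrow> (\<lambda>s. f (xt s) (s j)) \<in> borel_measurable SP"
proof -
  show "(\<lambda>w. f (xt (fst w)) (snd w)) \<in> borel_measurable Q"
    using measurable_compose[OF measurable_Pair[OF measurable_compose[OF measurable_fst xt_measurable] measurable_snd] f_measurable]
    by simp
  show "(\<lambda>s. f (xt s) (s j)) \<in> borel_measurable SP" if "j \<in> {1..N}"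
    using measurable_compose[OF measurable_Pair[OF xt_measurable SP_component(1)[OF that]] f_measurable] by simp
qed

section \<open>Integrability along the approximate solution\<close>

definition D :: "(nat \<Rightarrow> vec) \<Rightarrow> real" where
  "D s = pnorm d q (vdiff xs (xt s))"

lemma D_nonneg [simp]: "0 \<le> D s"
  by (simp add: D_def)

lemma D_measurable [measurable]: "D \<in> borel_measurable SP"
  unfolding D_def[abs_def] by measurable

lemma es_component: "j \<in> {1..N} \<Longrightarrow> square_integrable SP (\<lambda>s. es (s j))"
  using square_integrable_compose(1)[OF SP_component es_square] by simp

lemma f_xt_lower: "AE s in SP. \<forall>j\<in>{1..N}. f xs (s j) - (c + es (s j)) * D s \<le> f (xt s) (s j)"
  using AE_components[OF sub_xs] AE_xt_in_X
  by eventually_elim (auto simp: D_def pnorm_vdiff_commute[of d q xs])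

text \<open>Strong convexity against \<open>xs\<close> yields
  \<open>\<kappa> * (D s)\<^sup>2 \<le> b s * D s + lam * V xs\<close> with a square integrable
  \<open>b\<close>, a quadratic inequality for \<open>D s\<close>.\<close>

lemma D_square_integrable: "square_integrable SP D"
proof -
  define b where "b = (\<lambda>s. \<delta> + c + (\<Sum>j=1..N. es (s j)) / real N)"
  have b: "square_integrable SP b"
    unfolding b_def using SP.finite_measure_axioms es_component
    by (intro square_integrable_add square_integrable_divide square_integrable_sum) auto
  have "integrable SP (\<lambda>s. (D s)\<^sup>2)"
  proof (rule Bochner_Integration.integrable_bound)
    show "integrable SP (\<lambda>s. (b s)\<^sup>2 / \<kappa>\<^sup>2 + 2 * lam * V xs / \<kappa>)"
      using b by (intro Bochner_Integration.integrable_add integrable_divide SP.integrable_const) (simp add: square_integrable_def)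
    show "AE s in SP. norm ((D s)\<^sup>2) \<le> norm ((b s)\<^sup>2 / \<kappa>\<^sup>2 + 2 * lam * V xs / \<kappa>)"
      using approx f_xt_lower
    proof eventually_elim
      case (elim s)
      have "(\<Sum>j=1..N. f xs (s j)) - (real N * c + (\<Sum>j=1..N. es (s j))) * D s = (\<Sum>j=1..N. f xs (s j) - (c + es (s j)) * D s)"
        by (simp add: sum_subtractf sum_distrib_right[symmetric] sum.distrib)
      also have "\<dots> \<le> (\<Sum>j=1..N. f (xt s) (s j))"
        using elim(2) by (intro sum_mono) auto
      finally have "((\<Sum>j=1..N. f xs (s j)) - (real N * c + (\<Sum>j=1..N. es (s j))) * D s) / real N \<le> (\<Sum>j=1..N. f (xt s) (s j)) / real N"
        by (intro divide_right_mono) auto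
      moreover have "((\<Sum>j=1..N. f xs (s j)) - (real N * c + (\<Sum>j=1..N. es (s j))) * D s) / real N
          = (\<Sum>j=1..N. f xs (s j)) / real N - (b s - \<delta>) * D s"
        using N by (simp add: b_def field_simps)
      moreover have "(\<Sum>j=1..N. f (xt s) (s j)) / real N + lam * V (xt s) - \<delta> * D s + \<kappa> * (D s)\<^sup>2
          \<le> (\<Sum>j=1..N. f xs (s j)) / real N + lam * V xs"
        using elim(1) xs(1) by (auto simp: D_def)
      moreover have "0 \<le> lam * V (xt s)" using params V_nonneg by simp
      ultimately have 1: "\<kappa> * (D s)\<^sup>2 \<le> b s * D s + lam * V xs"
        by (simp add: algebra_simps)
      \<comment> \<open>Young's inequality: the mixed term is absorbed into half of the quadratic
        one.\<close>
      have "0 \<le> (\<kappa> * D s - b s)\<^sup>2" by simp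
      then have "2 * \<kappa> * (b s * D s) \<le> \<kappa>\<^sup>2 * (D s)\<^sup>2 + (b s)\<^sup>2"
        by (simp add: power2_eq_square algebra_simps)
      moreover have "2 * \<kappa> * (\<kappa> * (D s)\<^sup>2) \<le> 2 * \<kappa> * (b s * D s + lam * V xs)"
        using 1 params by (intro mult_left_mono) auto
      ultimately have "\<kappa>\<^sup>2 * (D s)\<^sup>2 \<le> (b s)\<^sup>2 + \<kappa> * (2 * lam * V xs)"
        by (simp add: power2_eq_square algebra_simps)
      then have "(D s)\<^sup>2 \<le> ((b s)\<^sup>2 + \<kappa> * (2 * lam * V xs)) / \<kappa>\<^sup>2"
        using params by (simp add: field_simps)
      also have "\<dots> = (b s)\<^sup>2 / \<kappa>\<^sup>2 + 2 * lam * V xs / \<kappa>"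
        using params by (simp add: add_divide_distrib power2_eq_square)
      finally show ?case by simp
    qed
  qed simp
  then show ?thesis by (simp add: square_integrable_def)
qed

lemma D_integrable: "integrable SP D"
  using SP.finite_measure_axioms D_square_integrable by (rule square_integrable_imp_integrable)

text \<open>Minimality of \<open>xs\<close> bounds the gap from below, \<open>F_growth\<close> from
  above by a quadratic polynomial in \<open>D\<close>.\<close>

lemma F_xt_integrable: "integrable SP (\<lambda>s. F (xt s))"
proof -
  have "integrable SP (\<lambda>s. F (xt s) - F xs)"
  proof (rule Bochner_Integration.integrable_bound)
    show "integrable SP (\<lambda>s. L * (D s)\<^sup>2 + (2 * M + c) * D s)"
      using D_square_integrable D_integrable by (auto simp: square_integrable_def)
    show "AE s in SP. norm (F (xt s) - F xs) \<le> norm (L * (D s)\<^sup>2 + (2 * M + c) * D s)"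
      using AE_xt_in_X
    proof eventually_elim
      case (elim s)
      show ?case using F_growth[OF elim] xs(2)[OF elim] by (simp add: D_def pnorm_vdiff_commute)
    qed
  qed measurable
  then have "integrable SP (\<lambda>s. F (xt s) - F xs + F xs)"
    by (intro Bochner_Integration.integrable_add) auto
  then show ?thesis by simp
qed

text \<open>A lower bound of \<open>f (xt s) (s j)\<close>, taken from the noisy subgradient at
  \<open>xs\<close>: the noise bound at \<open>xt s\<close> concerns only observations independent
  of the sample.\<close>

definition lower_f :: "(nat \<Rightarrow> vec) \<Rightarrow> nat \<Rightarrow> real" where
  "lower_f s j = f xs (s j) - (c + es (s j)) * D s"

lemma lower_f_integrable:
  assumes "j \<in> {1..N}"
  shows "integrable SP (\<lambda>s. lower_f s j)"
  unfolding lower_f_def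
  using integrable_component(1)[OF assms f_integrable[OF xs(1)]] SP.finite_measure_axioms
  by (intro Bochner_Integration.integrable_diff square_integrable_mult square_integrable_add es_component assms
      D_square_integrable) auto

lemma sample_objective_integral:
  assumes "u \<in> X"
  shows "integrable SP (\<lambda>s. (\<Sum>j=1..N. f u (s j)) / real N)"
    and "(\<integral>s. (\<Sum>j=1..N. f u (s j)) / real N \<partial>SP) = F u"
proof -
  note fu = integrable_component[OF _ f_integrable[OF assms]]
  show "integrable SP (\<lambda>s. (\<Sum>j=1..N. f u (s j)) / real N)"
    using fu(1) by (intro integrable_divide Bochner_Integration.integrable_sum)
  show "(\<integral>s. (\<Sum>j=1..N. f u (s j)) / real N \<partial>SP) = F u"
    using fu N by (simp add: F_def)
qed

lemma approx_xs:
  "AE s in SP. (\<Sum>j=1..N. f (xt s) (s j)) / real N + lam * V (xt s)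
    \<le> (\<Sum>j=1..N. f xs (s j)) / real N + lam * V xs + \<delta> * D s"
  using approx
proof eventually_elim
  case (elim s)
  have "0 \<le> \<kappa> * (D s)\<^sup>2" using params by simp
  moreover have "(\<Sum>j=1..N. f (xt s) (s j)) / real N + lam * V (xt s) - \<delta> * D s + \<kappa> * (D s)\<^sup>2
          \<le> (\<Sum>j=1..N. f xs (s j)) / real N + lam * V xs"
    using elim xs(1) by (auto simp: D_def)
  ultimately show ?case by simp
qed

text \<open>Approximate optimality bounds only the average from above. Each excess over
  \<open>lower_f\<close> is nonnegative and therefore at most the sum of all of them.\<close>

lemma f_xt_integrable:
  assumes "j \<in> {1..N}"
  shows "integrable SP (\<lambda>s. f (xt s) (s j))"
proof -
  define U where "U = (\<lambda>s. real N * ((\<Sum>j=1..N. f xs (s j)) / real N + lam * V xs + \<delta> * D s) - (\<Sum>j=1..N. lower_f s j))"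
  have "integrable SP (\<lambda>s. f (xt s) (s j) - lower_f s j)"
  proof (rule Bochner_Integration.integrable_bound)
    show "integrable SP U"
      unfolding U_def using sample_objective_integral[OF xs(1)] D_integrable lower_f_integrable
      by (intro Bochner_Integration.integrable_diff Bochner_Integration.integrable_add integrable_mult_right
          Bochner_Integration.integrable_sum SP.integrable_const) auto
    show "AE s in SP. norm (f (xt s) (s j) - lower_f s j) \<le> norm (U s)"
      using approx_xs f_xt_lower
    proof eventually_elim
      case (elim s)
      have nn: "0 \<le> f (xt s) (s k) - lower_f s k" if "k \<in> {1..N}" for k
        using elim(2) that by (auto simp: lower_f_def)
      have "f (xt s) (s j) - lower_f s j \<le> (\<Sum>k=1..N. f (xt s) (s k) - lower_f s k)"
        using nn assms by (intro member_le_sum) auto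
      also have "\<dots> = real N * ((\<Sum>j=1..N. f (xt s) (s j)) / real N) - (\<Sum>j=1..N. lower_f s j)"
        using N by (simp add: sum_subtractf)
      also have "\<dots> \<le> U s"
      proof -
        have "0 \<le> lam * V (xt s)" using params V_nonneg by simp
        then have "(\<Sum>j=1..N. f (xt s) (s j)) / real N \<le> (\<Sum>j=1..N. f xs (s j)) / real N + lam * V xs + \<delta> * D s"
          using elim(1) by linarith
        then show ?thesis unfolding U_def by (intro diff_right_mono mult_left_mono) auto
      qed
      finally show ?case using nn[OF assms] by simp
    qed
    show "(\<lambda>s. f (xt s) (s j) - lower_f s j) \<in> borel_measurable SP"
      using f_xt_measurable(2)[OF assms] lower_f_integrable[OF assms] by (intro borel_measurable_diff) auto
  qed
  then have "integrable SP (\<lambda>s. f (xt s) (s j) - lower_f s j + lower_f s j)"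
    using lower_f_integrable[OF assms] by (intro Bochner_Integration.integrable_add)
  then show ?thesis by simp
qed

lemma sample_objective_integrable:
  "integrable SP (\<lambda>s. (\<Sum>j=1..N. f (xt s) (s j)) / real N)"
  using f_xt_integrable by (intro integrable_divide Bochner_Integration.integrable_sum)

lemma V_xt_integrable: "integrable SP (\<lambda>s. V (xt s))"
proof -
  define U where "U = (\<lambda>s. (\<Sum>j=1..N. f xs (s j)) / real N + lam * V xs + \<delta> * D s - (\<Sum>j=1..N. f (xt s) (s j)) / real N)"
  have "integrable SP (\<lambda>s. lam * V (xt s))"
  proof (rule Bochner_Integration.integrable_bound)
    show "integrable SP U"
      unfolding U_def using sample_objective_integral(1)[OF xs(1)] D_integrable sample_objective_integrable
      by (intro Bochner_Integration.integrable_diff Bochner_Integration.integrable_add integrable_mult_right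
          SP.integrable_const)
    show "AE s in SP. norm (lam * V (xt s)) \<le> norm (U s)"
      using approx_xs
    proof eventually_elim
      case (elim s)
      then have "lam * V (xt s) \<le> U s" by (simp add: U_def)
      moreover have "0 \<le> lam * V (xt s)" using params V_nonneg by simp
      ultimately show ?case by simp
    qed
  qed measurable
  then have "integrable SP (\<lambda>s. lam * V (xt s) / lam)" by (intro integrable_divide)
  then show ?thesis using params by simp
qed

text \<open>Fubini's theorem needs the absolute value. The lower bound from \<open>sub_xs\<close>
  controls the negative part of \<open>f (xt s)\<close>, so the inner integral is at most
  \<open>F (xt s)\<close> plus an affine function of \<open>D s\<close>.\<close>

lemma f_xt_fresh_integrable:
  shows "integrable Q (\<lambda>w. f (xt (fst w)) (snd w))"
    and "(\<integral>w. f (xt (fst w)) (snd w) \<partial>Q) = (\<integral>s. F (xt s) \<partial>SP)"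
proof -
  have es_int: "integrable P (\<lambda>z. c + es z)"
    using square_integrable_imp_integrable[OF P.finite_measure_axioms es_square] by simp
  have fs: "integrable P (f xs)" using f_integrable xs(1) by blast
  define H where "H = (\<lambda>s. F (xt s) + 2 * (\<integral>z. \<bar>f xs z\<bar> \<partial>P) + 2 * ((\<integral>z. \<bar>c + es z\<bar> \<partial>P) * D s))"
  show int: "integrable Q (\<lambda>w. f (xt (fst w)) (snd w))"
  proof (rule Q.Fubini_integrable[OF f_xt_measurable(1)])
    show "AE s in SP. integrable P (\<lambda>z. f (xt (fst (s, z))) (snd (s, z)))"
      using AE_xt_in_X by eventually_elim (simp add: f_integrable)
    show "integrable SP (\<lambda>s. \<integral>z. norm (f (xt (fst (s, z))) (snd (s, z))) \<partial>P)"
    proof (rule Bochner_Integration.integrable_bound)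
      show "integrable SP H"
        unfolding H_def using F_xt_integrable D_integrable
        by (intro Bochner_Integration.integrable_add integrable_mult_right SP.integrable_const)
      show "AE s in SP. norm (\<integral>z. norm (f (xt (fst (s, z))) (snd (s, z))) \<partial>P) \<le> norm (H s)"
        using AE_xt_in_X
      proof eventually_elim
        case (elim s)
        have fx: "integrable P (f (xt s))" using f_integrable elim by blast
        have "(\<integral>z. \<bar>f (xt s) z\<bar> \<partial>P) \<le> (\<integral>z. f (xt s) z + 2 * \<bar>f xs z\<bar> + 2 * (\<bar>c + es z\<bar> * D s) \<partial>P)"
        proof (rule integral_mono_AE)
          show "AE z in P. \<bar>f (xt s) z\<bar> \<le> f (xt s) z + 2 * \<bar>f xs z\<bar> + 2 * (\<bar>c + es z\<bar> * D s)"
            using sub_xs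
          proof eventually_elim
            case (elim z)
            then have "f xs z - (c + es z) * D s \<le> f (xt s) z"
              using \<open>xt s \<in> X\<close> by (auto simp: D_def pnorm_vdiff_commute)
            moreover have "(c + es z) * D s \<le> \<bar>c + es z\<bar> * D s" by (intro mult_right_mono) auto
            moreover have "0 \<le> \<bar>c + es z\<bar> * D s" by simp
            ultimately show ?case by linarith
          qed
        qed (use fx fs es_int in \<open>auto\<close>)
        also have "\<dots> = H s"
          using fx fs es_int by (simp add: H_def F_def)
        finally have "(\<integral>z. \<bar>f (xt s) z\<bar> \<partial>P) \<le> H s" .
        moreover have "0 \<le> (\<integral>z. \<bar>f (xt s) z\<bar> \<partial>P)" by simp
        ultimately show ?case by simp
      qed
      show "(\<lambda>s. \<integral>z. norm (f (xt (fst (s, z))) (snd (s, z))) \<partial>P) \<in> borel_measurable SP"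
        using f_xt_measurable(1) by (intro P.borel_measurable_lebesgue_integral) (simp add: split_beta')
    qed
  qed
  show "(\<integral>w. f (xt (fst w)) (snd w) \<partial>Q) = (\<integral>s. F (xt s) \<partial>SP)"
    using Q.integral_fst'[OF int] by (simp add: F_def)
qed

section \<open>Symmetrized stability estimate\<close>

lemma e_square_integrable:
  shows "square_integrable Q e" and "(\<integral>w. (e w)\<^sup>2 \<partial>Q) \<le> \<sigma>\<^sup>2"
  using square_integrable_nn_integral[OF e_measurable e_square] by auto

text \<open>The factor \<open>2 + V\<close> of \<open>stability_bound\<close>: the summand 2 stands
  for the tolerances of the two solutions, and one noise term belongs to each of them.\<close>

definition W :: "nat \<Rightarrow> (nat \<Rightarrow> vec) \<times> vec \<Rightarrow> real" where
  "W j w = 2 + 2 * M + e w + e (swap_sample j w)"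

lemma W_square:
  assumes "j \<in> {1..N}"
  shows "square_integrable Q (W j)" and "(\<integral>w. (W j w)\<^sup>2 \<partial>Q) \<le> 32 * (M\<^sup>2 + \<sigma>\<^sup>2)"
proof -
  note e = e_square_integrable
  note e' = square_integrable_compose[OF swap[OF assms] e(1)]
  show sq: "square_integrable Q (W j)"
    unfolding W_def[abs_def] using Q.P.finite_measure_axioms
    by (intro square_integrable_add e e' square_integrable_const)
  have ie: "integrable Q (\<lambda>w. (e w)\<^sup>2)" "integrable Q (\<lambda>w. (e (swap_sample j w))\<^sup>2)"
    using e(1) e'(1) by (simp_all add: square_integrable_def)
  have "(\<integral>w. (W j w)\<^sup>2 \<partial>Q) \<le> (\<integral>w. 4 * (2\<^sup>2 + (2 * M)\<^sup>2 + (e w)\<^sup>2 + (e (swap_sample j w))\<^sup>2) \<partial>Q)"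
  proof (rule integral_mono)
    show "integrable Q (\<lambda>w. 4 * (2\<^sup>2 + (2 * M)\<^sup>2 + (e w)\<^sup>2 + (e (swap_sample j w))\<^sup>2))"
      using ie by (intro integrable_mult_right Bochner_Integration.integrable_add Q.P.integrable_const)
    show "(W j w)\<^sup>2 \<le> 4 * (2\<^sup>2 + (2 * M)\<^sup>2 + (e w)\<^sup>2 + (e (swap_sample j w))\<^sup>2)" for w
      unfolding W_def by (rule power2_sum4_le)
  qed (use sq in \<open>simp add: square_integrable_def\<close>)
  also have "\<dots> = 4 * (2\<^sup>2 + (2 * M)\<^sup>2 + (\<integral>w. (e w)\<^sup>2 \<partial>Q) + (\<integral>w. (e (swap_sample j w))\<^sup>2 \<partial>Q))"
    using ie by (simp add: Q.P.prob_space)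
  also have "\<dots> \<le> 4 * (2\<^sup>2 + (2 * M)\<^sup>2 + \<sigma>\<^sup>2 + \<sigma>\<^sup>2)"
    using e(2) e'(2) by simp
  also have "\<dots> \<le> 32 * (M\<^sup>2 + \<sigma>\<^sup>2)"
  proof -
    \<comment> \<open>The constant 16 left by the tolerances is at most
      \<open>16 * M\<^sup>2\<close>, since \<open>1 \<le> M\<close>.\<close>
    have "4 * (4 + 4 * m + t + t) \<le> 32 * (m + t)" if "1 \<le> m" "0 \<le> t" for m t :: real
      using that by simp
    from this[of "M\<^sup>2" "\<sigma>\<^sup>2"] show ?thesis using params by (simp add: power_mult_distrib)
  qed
  finally show "(\<integral>w. (W j w)\<^sup>2 \<partial>Q) \<le> 32 * (M\<^sup>2 + \<sigma>\<^sup>2)" .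
qed

definition fresh :: "(nat \<Rightarrow> vec) \<times> vec \<Rightarrow> real" where
  "fresh w = f (xt (fst w)) (snd w)"

text \<open>Composed with the exchange, \<open>fresh\<close> evaluates the new solution at the
  removed entry, and \<open>used j\<close> evaluates it at the entry that replaced it.\<close>

definition used :: "nat \<Rightarrow> (nat \<Rightarrow> vec) \<times> vec \<Rightarrow> real" where
  "used j w = f (xt (fst w)) (fst w j)"

lemma stability_AE:
  assumes j: "j \<in> {1..N}"
  shows "AE w in Q. fresh (swap_sample j w) - used j w + (fresh w - used j (swap_sample j w))
    \<le> 2 * (W j w)\<^sup>2 / (\<kappa> * real N)"
  using AE_SP_Q[OF AE_xt_in_X] AE_swap[OF j AE_SP_Q[OF AE_xt_in_X]]
    AE_SP_Q[OF approx] AE_swap[OF j AE_SP_Q[OF approx]] sub AE_swap[OF j sub]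
proof eventually_elim
  case (elim w)
  obtain s z where w: "w = (s, z)" by (cases w)
  define s' where "s' = s(j := z)"
  define x where "x = xt s"
  define x' where "x' = xt s'"
  define Dx where "Dx = pnorm d q (vdiff x' x)"
  define A where "A = f x' (s j) - f x (s j) + (f x z - f x' z)"
  have sw: "swap_sample j w = (s', s j)" by (simp add: w swap_sample_def s'_def)
  have Dx': "pnorm d q (vdiff x x') = Dx" by (simp add: Dx_def pnorm_vdiff_commute)
  have X: "x \<in> X" "x' \<in> X" using elim(1,2) unfolding sw by (auto simp: w x_def x'_def)
  have sum': "(\<Sum>k=1..N. f y (s' k)) = (\<Sum>k=1..N. f y (s k)) - f y (s j) + f y z" for y
  proof -
    have "(\<Sum>k=1..N. f y (s' k)) = f y (s' j) + (\<Sum>k\<in>{1..N}-{j}. f y (s' k))"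
      using j by (intro sum.remove) auto
    also have "(\<Sum>k\<in>{1..N}-{j}. f y (s' k)) = (\<Sum>k\<in>{1..N}-{j}. f y (s k))"
      by (intro sum.cong) (auto simp: s'_def)
    finally show ?thesis using j sum.remove[of "{1..N}" j "\<lambda>k. f y (s k)"] by (simp add: s'_def)
  qed
  define S where "S = (\<lambda>y. (\<Sum>k=1..N. f y (s k)) / real N)"
  have S': "(\<Sum>k=1..N. f y (s' k)) / real N = S y - (f y (s j) - f y z) / real N" for y
    unfolding sum' S_def by (simp add: add_divide_distrib diff_divide_distrib)
  have a1: "S x + lam * V x - \<delta> * Dx + \<kappa> * Dx\<^sup>2 \<le> S x' + lam * V x'"
    using bspec[OF elim(3) X(2)] by (simp add: w x_def[symmetric] S_def Dx_def)
  have a2: "S x' - (f x' (s j) - f x' z) / real N + lam * V x' - \<delta> * Dx + \<kappa> * Dx\<^sup>2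
      \<le> S x - (f x (s j) - f x z) / real N + lam * V x"
    using bspec[OF elim(4) X(1)] by (simp add: sw x'_def[symmetric] S' Dx')
  \<comment> \<open>Each solution has been tested against the other. In the sum the regularizer and
    all entries but the \<open>j\<close>-th cancel.\<close>
  have "2 * \<kappa> * Dx\<^sup>2 \<le> 2 * \<delta> * Dx + A / real N"
    using a1 a2 by (simp add: A_def add_divide_distrib diff_divide_distrib)
  then have "real N * (2 * \<kappa> * Dx\<^sup>2) \<le> real N * (2 * \<delta> * Dx + A / real N)"
    by (intro mult_left_mono) auto
  then have "2 * (\<kappa> * real N) * Dx\<^sup>2 \<le> 2 * (real N * \<delta>) * Dx + A"
    using N by (simp add: algebra_simps)
  moreover have "real N * \<delta> \<le> 1" using params(2) N by (simp add: field_simps)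
  then have "2 * (real N * \<delta>) * Dx \<le> 2 * Dx"
    by (intro mult_right_mono) (auto simp: Dx_def)
  ultimately have 1: "2 * (\<kappa> * real N) * Dx\<^sup>2 \<le> 2 * Dx + A" by linarith
  \<comment> \<open>The subgradient inequalities are taken at \<open>(x, z)\<close> and
    \<open>(x', s j)\<close>, the pairs in which the observation did not enter the solution.\<close>
  have "f x z + dot d (g x) (vdiff x' x) - e w * Dx \<le> f x' z"
    using bspec[OF elim(5) X(2)] by (simp add: w x_def[symmetric] Dx_def)
  moreover have "f x' (s j) + dot d (g x') (vdiff x x') - e (swap_sample j w) * Dx \<le> f x (s j)"
    using bspec[OF elim(6) X(1)] by (simp add: sw x'_def[symmetric] Dx')
  \<comment> \<open>The two inner products combine into one with the difference of the mean
    subgradients, to which \<open>g_mono\<close> applies.\<close>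
  moreover have "dot d (vdiff (g x') (g x)) (vdiff x' x) = - dot d (g x') (vdiff x x') - dot d (g x) (vdiff x' x)"
    by (simp add: dot_def vdiff_def sum_negf[symmetric] sum_subtractf[symmetric] algebra_simps)
  moreover have "dot d (vdiff (g x') (g x)) (vdiff x' x) \<le> L * Dx\<^sup>2 + 2 * M * Dx"
    using g_mono[OF X(2,1)] by (simp add: Dx_def)
  ultimately have 2: "A \<le> L * Dx\<^sup>2 + (2 * M + e w + e (swap_sample j w)) * Dx"
    by (simp add: A_def algebra_simps)
  have "A \<le> 2 * (2 + (2 * M + e w + e (swap_sample j w)))\<^sup>2 / (\<kappa> * real N)"
    using params N e_nonneg[of w] e_nonneg[of "swap_sample j w"]
    by (intro stability_bound[OF _ _ _ _ 1 2]) (auto simp: Dx_def)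
  then show ?case
    by (simp only: fresh_def used_def sw) (simp add: A_def w x_def x'_def W_def s'_def sw[unfolded w] add.assoc)
qed

lemma fresh_used_gap:
  assumes j: "j \<in> {1..N}"
  shows "(\<integral>s. F (xt s) \<partial>SP) - (\<integral>s. f (xt s) (s j) \<partial>SP) \<le> 32 * (M\<^sup>2 + \<sigma>\<^sup>2) / (\<kappa> * real N)"
proof -
  have fi: "integrable Q fresh" and fe: "(\<integral>w. fresh w \<partial>Q) = (\<integral>s. F (xt s) \<partial>SP)"
    using f_xt_fresh_integrable unfolding fresh_def[abs_def] by auto
  have ui: "integrable Q (used j)" and ue: "(\<integral>w. used j w \<partial>Q) = (\<integral>s. f (xt s) (s j) \<partial>SP)"
    using integrable_fst[OF f_xt_integrable[OF j]] unfolding used_def[abs_def] by auto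
  note fi' = integrable_swap[OF j fi] and ui' = integrable_swap[OF j ui]
  have "2 * ((\<integral>s. F (xt s) \<partial>SP) - (\<integral>s. f (xt s) (s j) \<partial>SP))
      = (\<integral>w. fresh (swap_sample j w) - used j w + (fresh w - used j (swap_sample j w)) \<partial>Q)"
    using fi ui fi' ui' by (simp add: fe ue)
  also have "\<dots> \<le> (\<integral>w. 2 * (W j w)\<^sup>2 / (\<kappa> * real N) \<partial>Q)"
    using fi ui fi'(1) ui'(1) W_square(1)[OF j] unfolding square_integrable_def
    by (intro integral_mono_AE stability_AE j) auto
  also have "\<dots> = 2 * (\<integral>w. (W j w)\<^sup>2 \<partial>Q) / (\<kappa> * real N)" by simp
  also have "\<dots> \<le> 2 * (32 * (M\<^sup>2 + \<sigma>\<^sup>2)) / (\<kappa> * real N)"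
    using W_square(2)[OF j] params N by (intro divide_right_mono mult_left_mono) auto
  also have "\<dots> = 2 * (32 * (M\<^sup>2 + \<sigma>\<^sup>2) / (\<kappa> * real N))" by simp
  finally show ?thesis by (rule mult_left_le_imp_le) simp
qed

text \<open>Averaging \<open>fresh_used_gap\<close> over the entries yields 32 of the constant 33,
  the tolerance the remaining 1. The comparison point \<open>u\<close> is arbitrary so that the
  infimum over \<open>X\<close> can be taken afterwards.\<close>

lemma expected_regularized_objective:
  assumes u: "u \<in> X"
  shows "(\<integral>s. F (xt s) + lam * V (xt s) \<partial>SP) \<le> F u + lam * V u + 33 * (M\<^sup>2 + \<sigma>\<^sup>2) / (\<kappa> * real N)"
proof -
  have pos: "0 < \<kappa> * real N" using params N by simp
  define E where "E = (\<integral>s. F (xt s) \<partial>SP)"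
  define EN where "EN = (\<integral>s. (\<Sum>j=1..N. f (xt s) (s j)) / real N \<partial>SP)"
  define \<eta> where "\<eta> = 32 * (M\<^sup>2 + \<sigma>\<^sup>2) / (\<kappa> * real N)"
  have "EN + lam * (\<integral>s. V (xt s) \<partial>SP) = (\<integral>s. (\<Sum>j=1..N. f (xt s) (s j)) / real N + lam * V (xt s) \<partial>SP)"
    unfolding EN_def using sample_objective_integrable V_xt_integrable by (subst Bochner_Integration.integral_add) auto
  also have "\<dots> \<le> (\<integral>s. (\<Sum>j=1..N. f u (s j)) / real N + (lam * V u + \<delta>\<^sup>2 / (4 * \<kappa>)) \<partial>SP)"
  proof (rule integral_mono_AE)
    show "AE s in SP. (\<Sum>j=1..N. f (xt s) (s j)) / real N + lam * V (xt s)
        \<le> (\<Sum>j=1..N. f u (s j)) / real N + (lam * V u + \<delta>\<^sup>2 / (4 * \<kappa>))"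
      using approx
    proof eventually_elim
      case (elim s)
      define t where "t = pnorm d q (vdiff u (xt s))"
      \<comment> \<open>Completing the square: the strong convexity term pays for the tolerance up
        to \<open>\<delta>\<^sup>2 / (4 * \<kappa>)\<close>, whatever the distance to
        \<open>u\<close>.\<close>
      have "0 \<le> (2 * \<kappa> * t - \<delta>)\<^sup>2 / (4 * \<kappa>)" using params by simp
      then have "\<delta> * t - \<kappa> * t\<^sup>2 \<le> \<delta>\<^sup>2 / (4 * \<kappa>)"
        using params by (simp add: power2_eq_square field_simps)
      moreover have "(\<Sum>j=1..N. f (xt s) (s j)) / real N + lam * V (xt s) - \<delta> * t + \<kappa> * t\<^sup>2
          \<le> (\<Sum>j=1..N. f u (s j)) / real N + lam * V u"
        using elim u by (simp add: t_def)
      ultimately show ?case by linarith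
    qed
  qed (use sample_objective_integrable V_xt_integrable sample_objective_integral[OF u]
      in \<open>auto\<close>)
  also have "\<dots> = F u + (lam * V u + \<delta>\<^sup>2 / (4 * \<kappa>))"
    using sample_objective_integral[OF u]
    by (subst Bochner_Integration.integral_add) (auto simp: SP.prob_space)
  finally have 1: "EN + lam * (\<integral>s. V (xt s) \<partial>SP) \<le> F u + lam * V u + \<delta>\<^sup>2 / (4 * \<kappa>)" by simp
  have "real N * (E - EN) = (\<Sum>j=1..N. E - (\<integral>s. f (xt s) (s j) \<partial>SP))"
    using N f_xt_integrable by (simp add: EN_def sum_subtractf algebra_simps)
  also have "\<dots> \<le> (\<Sum>j=1..N. \<eta>)"
    unfolding E_def \<eta>_def by (intro sum_mono fresh_used_gap)
  finally have 2: "E - EN \<le> \<eta>" using N by simp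
  have "\<delta>\<^sup>2 \<le> (1 / real N)\<^sup>2" using params by (intro power_mono) auto
  also have "\<dots> \<le> 1 / real N" using N by (simp add: power2_eq_square field_simps)
  finally have "\<delta>\<^sup>2 / (4 * \<kappa>) \<le> (1 / real N) / (4 * \<kappa>)" using params by (intro divide_right_mono) auto
  also have "\<dots> \<le> 1 / (\<kappa> * real N)" using params N by (simp add: field_simps)
  also have "\<dots> \<le> (M\<^sup>2 + \<sigma>\<^sup>2) / (\<kappa> * real N)"
  proof -
    have "1 \<le> M\<^sup>2" using params by simp
    then have "1 \<le> M\<^sup>2 + \<sigma>\<^sup>2" using zero_le_power2[of \<sigma>] by linarith
    then show ?thesis using pos by (intro divide_right_mono) auto
  qed
  finally have 3: "\<delta>\<^sup>2 / (4 * \<kappa>) \<le> (M\<^sup>2 + \<sigma>\<^sup>2) / (\<kappa> * real N)" .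
  have "33 * (M\<^sup>2 + \<sigma>\<^sup>2) / (\<kappa> * real N) = \<eta> + (M\<^sup>2 + \<sigma>\<^sup>2) / (\<kappa> * real N)"
    by (simp add: \<eta>_def add_divide_distrib[symmetric])
  moreover have "(\<integral>s. F (xt s) + lam * V (xt s) \<partial>SP) = E + lam * (\<integral>s. V (xt s) \<partial>SP)"
    unfolding E_def using F_xt_integrable V_xt_integrable by simp
  ultimately show ?thesis using 1 2 3 by linarith
qed

end

section \<open>Noise of the stochastic subgradients\<close>

lemma pnorm_scale:
  assumes "p > 0" "0 \<le> c"
  shows "pnorm d p (\<lambda>i. c * x i) = c * pnorm d p x"
  using assms by (simp add: pnorm_def abs_mult powr_mult sum_distrib_left[symmetric] sum_nonneg powr_powr)

lemma pnorm_cong: "(\<And>i. i < d \<Longrightarrow> x i = y i) \<Longrightarrow> pnorm d p x = pnorm d p y"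
  by (simp add: pnorm_def)

lemma dot_diff_left: "dot d (vdiff x y) z = dot d x z - dot d y z"
  by (simp add: dot_def vdiff_def sum_subtractf[symmetric] algebra_simps)

lemma dot_vdiff_minus: "dot d z (vdiff x y) = - dot d z (vdiff y x)"
  by (simp add: dot_def vdiff_def sum_negf[symmetric] algebra_simps)

text \<open>\<open>pnorm_uniformly_convex\<close> for the displacements from \<open>x0\<close>, with
  mean \<open>a\<close> and half difference \<open>b\<close>. Squaring that half and the factor 1/2
  of \<open>reg_V\<close> give the 8.\<close>

lemma reg_V_midpoint:
  assumes p: "1 < p" "p \<le> 2"
  shows "reg_V d p x0 (cvx_comb (1/2) x y)
    \<le> (reg_V d p x0 x + reg_V d p x0 y) / 2 - (p - 1) / 8 * (pnorm d p (vdiff y x))\<^sup>2"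
proof -
  define a where "a = vdiff (cvx_comb (1/2) x y) x0"
  define b where "b = (\<lambda>i. 1/2 * vdiff y x i)"
  have "(\<lambda>i. a i + b i) = vdiff y x0" "(\<lambda>i. a i - b i) = vdiff x x0"
    by (auto simp: a_def b_def vdiff_def cvx_comb_def fun_eq_iff field_simps)
  then have "(pnorm d p a)\<^sup>2 + (p - 1) * (pnorm d p b)\<^sup>2 \<le> ((pnorm d p (vdiff y x0))\<^sup>2 + (pnorm d p (vdiff x x0))\<^sup>2) / 2"
    using pnorm_uniformly_convex[OF p, of d a b] by simp
  moreover have "pnorm d p b = 1/2 * pnorm d p (vdiff y x)"
    unfolding b_def using p by (intro pnorm_scale) auto
  ultimately show ?thesis
    by (simp add: reg_V_def a_def field_simps)
qed

text \<open>The subgradient inequality is tested at the midpoint, which avoids differentiating the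
  regularizer. Doubling the midpoint gain \<open>lam * (q' - 1) / 8\<close> gives the 4.\<close>

lemma F_reg_strong_convexity:
  assumes q: "1 < q'" "q' \<le> 2" "q' \<le> q" and lam: "0 \<le> lam" and N: "N \<ge> 1"
    and B: "vconvex B" and conv: "\<And>j. j \<in> {1..N} \<Longrightarrow> vconvex_on B (\<lambda>x. f x (s j))"
    and g: "g \<in> subdifferential d B (F_reg d f q' x0 lam N s) x"
    and y: "y \<in> B" and approx: "dot d g (vdiff y x) \<ge> - \<delta> * pnorm d q (vdiff y x)"
  shows "F_reg d f q' x0 lam N s x - \<delta> * pnorm d q (vdiff y x)
    + lam * (q' - 1) / 4 * (pnorm d q (vdiff y x))\<^sup>2 \<le> F_reg d f q' x0 lam N s y"
proof -
  define F where "F = F_reg d f q' x0 lam N s"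
  define v where "v = cvx_comb (1/2) x y"
  define t where "t = pnorm d q (vdiff y x)"
  have x: "x \<in> B" using g by (simp add: subdifferential_def)
  have v: "v \<in> B" using B x y unfolding vconvex_def v_def by auto
  have "F x + 1/2 * dot d g (vdiff y x) \<le> F v"
    using g v dot_cvx_comb[of d g "1/2" x y] unfolding subdifferential_def F_def v_def by auto
  also have "F v \<le> (F x + F y) / 2 - lam * (q' - 1) / 8 * (pnorm d q' (vdiff y x))\<^sup>2"
  proof -
    have "(\<Sum>j=1..N. f v (s j)) \<le> (\<Sum>j=1..N. (f x (s j) + f y (s j)) / 2)"
    proof (rule sum_mono)
      fix j assume "j \<in> {1..N}"
      from conv[OF this] x y have "f v (s j) \<le> (1 - 1/2) * f x (s j) + 1/2 * f y (s j)"
        unfolding vconvex_on_def v_def by (smt (verit) atLeastAtMost_iff divide_nonneg_nonneg half_bounded_equal)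
      then show "f v (s j) \<le> (f x (s j) + f y (s j)) / 2" by simp
    qed
    then have "(\<Sum>j=1..N. f v (s j)) / real N \<le> ((\<Sum>j=1..N. f x (s j)) / real N + (\<Sum>j=1..N. f y (s j)) / real N) / 2"
      using N by (simp add: sum.distrib sum_divide_distrib[symmetric] field_simps)
    moreover have "lam * reg_V d q' x0 v \<le> lam * ((reg_V d q' x0 x + reg_V d q' x0 y) / 2 - (q' - 1) / 8 * (pnorm d q' (vdiff y x))\<^sup>2)"
      unfolding v_def using lam q by (intro mult_left_mono reg_V_midpoint) auto
    ultimately show ?thesis by (simp add: F_def F_reg_def algebra_simps)
  qed
  \<comment> \<open>Here \<open>q' \<le> q\<close> enters: the \<open>q\<close>-norm is the smaller
    one.\<close>
  also have "\<dots> \<le> (F x + F y) / 2 - lam * (q' - 1) / 8 * t\<^sup>2"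
  proof -
    have "t\<^sup>2 \<le> (pnorm d q' (vdiff y x))\<^sup>2"
      unfolding t_def using q by (intro power_mono pnorm_mono_exponent) auto
    then have "lam * (q' - 1) / 8 * t\<^sup>2 \<le> lam * (q' - 1) / 8 * (pnorm d q' (vdiff y x))\<^sup>2"
      using lam q by (intro mult_left_mono) auto
    then show ?thesis by simp
  qed
  finally have "F x + dot d g (vdiff y x) + lam * (q' - 1) / 4 * t\<^sup>2 \<le> F y"
    by (simp add: field_simps)
  then show ?thesis using approx by (simp add: F_def t_def)
qed

section \<open>Mean subgradients and their measurable noise bounds\<close>

context stochastic_program
begin

abbreviation "P \<equiv> distr M (borel_on \<Xi>) \<xi>"

definition mean_G :: "vec \<Rightarrow> vec" where
  "mean_G x = (\<lambda>i. \<integral>\<omega>. G x (\<xi> \<omega>) i \<partial>M)"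

lemma prob_space_P: "prob_space P"
  using \<xi>_rv by (rule prob_space_distr)

lemma f_section_measurable:
  assumes "x \<in> B"
  shows "f x \<in> borel_measurable (borel_on \<Xi>)"
proof -
  have "(\<lambda>z. (x, z)) \<in> measurable (borel_on \<Xi>) (borel_on B \<Otimes>\<^sub>M borel_on \<Xi>)"
    using assms by (intro measurable_Pair measurable_const) (auto simp: space_restrict_space)
  from measurable_compose[OF this f_measurable] show ?thesis by simp
qed

lemma f_X_measurable: "(\<lambda>(x, z). f x z) \<in> borel_measurable (borel_on X \<Otimes>\<^sub>M P)"
proof -
  have "(\<lambda>x. x) \<in> measurable (borel_on X) (borel_on B)"
    using X_subset by (intro measurable_restrict_space2 measurable_restrict_space1) (auto simp: space_restrict_space)
  then have "(\<lambda>w. (fst w, snd w)) \<in> measurable (borel_on X \<Otimes>\<^sub>M P) (borel_on B \<Otimes>\<^sub>M borel_on \<Xi>)"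
    by (intro measurable_Pair measurable_compose[OF measurable_fst]) auto
  from measurable_compose[OF this f_measurable] show ?thesis by (simp add: split_beta')
qed

lemma objective_eq:
  assumes "x \<in> B"
  shows "objective M \<xi> f x = (\<integral>z. f x z \<partial>P)"
  unfolding objective_def using integral_distr[OF \<xi>_rv f_section_measurable[OF assms]] by simp

lemma integrable_P_iff:
  assumes "x \<in> B"
  shows "integrable P (f x) \<longleftrightarrow> integrable M (\<lambda>\<omega>. f x (\<xi> \<omega>))"
  by (rule integrable_distr_eq[OF \<xi>_rv f_section_measurable[OF assms]])

lemma G_AE:
  assumes "x \<in> X"
  shows "AE \<omega> in M. G x (\<xi> \<omega>) \<in> subdifferential d B (\<lambda>y. f y (\<xi> \<omega>)) x"
  using AE_distrD[OF \<xi>_rv G_subgradient[OF assms]] .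

text \<open>The pointwise subgradient inequalities are integrated. This makes the residual bound of
  \<open>composite_structure\<close> available for the mean of \<open>G\<close>.\<close>

lemma mean_G_subgradient:
  assumes x: "x \<in> X" and var: "bounded_variance M d \<xi> X G p \<sigma>"
  shows "mean_G x \<in> subdifferential d (objective_dom M \<xi> f B) (objective M \<xi> f) x"
proof -
  have int: "integrable M (\<lambda>\<omega>. G x (\<xi> \<omega>) i)" if "i < d" for i
    using var x that by (auto simp: bounded_variance_def)
  have xD: "x \<in> objective_dom M \<xi> f B"
    using x X_subset f_integrable by (auto simp: objective_dom_def)
  \<comment> \<open>Almost surely \<open>G x (\<xi> \<omega>)\<close> lies in \<open>Rn d\<close>,
    whose elements vanish from index \<open>d\<close> on.\<close>
  have "mean_G x i = 0" if "i \<ge> d" for i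
    unfolding mean_G_def using G_AE[OF x] that
    by (intro integral_eq_zero_AE) (auto simp: subdifferential_def topspace_Euclidean_space elim: eventually_mono)
  then have "mean_G x \<in> Rn d" by (simp add: topspace_Euclidean_space)
  moreover have "objective M \<xi> f x + dot d (mean_G x) (vdiff y x) \<le> objective M \<xi> f y"
    if y: "y \<in> objective_dom M \<xi> f B" for y
  proof -
    have fx: "integrable M (\<lambda>\<omega>. f x (\<xi> \<omega>))" and fy: "integrable M (\<lambda>\<omega>. f y (\<xi> \<omega>))"
      using xD y by (auto simp: objective_dom_def)
    have dot_int: "integrable M (\<lambda>\<omega>. dot d (G x (\<xi> \<omega>)) (vdiff y x))"
      unfolding dot_def using int by (intro Bochner_Integration.integrable_sum integrable_mult_left) auto
    have "(\<integral>\<omega>. dot d (G x (\<xi> \<omega>)) (vdiff y x) \<partial>M) = dot d (mean_G x) (vdiff y x)"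
      unfolding dot_def mean_G_def using int
      by (subst Bochner_Integration.integral_sum) auto
    then have "objective M \<xi> f x + dot d (mean_G x) (vdiff y x) = (\<integral>\<omega>. f x (\<xi> \<omega>) + dot d (G x (\<xi> \<omega>)) (vdiff y x) \<partial>M)"
      unfolding objective_def using fx dot_int by simp
    also have "\<dots> \<le> objective M \<xi> f y"
      unfolding objective_def using G_AE[OF x] fx fy dot_int y
      by (intro integral_mono_AE) (auto simp: subdifferential_def objective_dom_def elim: eventually_mono)
    finally show ?thesis .
  qed
  ultimately show ?thesis using xD by (simp add: subdifferential_def)
qed

text \<open>The law of \<open>(h s, z)\<close> is a Borel measure on \<open>X \<times> \<Xi>\<close>, so \<open>G\<close> agrees almost surely with a Borel
  function there. The exceptional set of the subgradient inequality a priori depends on the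
  comparison point \<open>y\<close>, which is why it is first established at rational points only.\<close>

lemma noise_bound:
  assumes S: "prob_space S" and h: "h \<in> measurable S (borel_on X)"
    and conv: "AE z in P. vconvex_on B (\<lambda>x. f x z)"
    and var: "bounded_variance M d \<xi> X G p \<sigma>" and p: "1 \<le> p" "p \<le> q / (q - 1)" and q: "1 < q"
  obtains e where "e \<in> borel_measurable (borel_on X \<Otimes>\<^sub>M P)" "\<forall>w. 0 \<le> e w"
    "AE s in S. (\<integral>\<^sup>+z. ennreal ((e (h s, z))\<^sup>2) \<partial>P) \<le> ennreal (\<sigma>\<^sup>2)"
    "AE w in S \<Otimes>\<^sub>M P. \<forall>y\<in>B. f (h (fst w)) (snd w) + dot d (mean_G (h (fst w))) (vdiff y (h (fst w)))
      - e (h (fst w), snd w) * pnorm d q (vdiff y (h (fst w))) \<le> f y (snd w)"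
proof -
  interpret S: prob_space S by fact
  interpret P: prob_space P by (rule prob_space_P)
  interpret SP: pair_prob_space S P ..
  define \<nu> where "\<nu> = distr (S \<Otimes>\<^sub>M P) (borel_on X \<Otimes>\<^sub>M borel_on \<Xi>) (\<lambda>w. (h (fst w), snd w))"
  have hz: "(\<lambda>w. (h (fst w), snd w)) \<in> measurable (S \<Otimes>\<^sub>M P) (borel_on X \<Otimes>\<^sub>M borel_on \<Xi>)"
    using h by (intro measurable_Pair measurable_compose[OF measurable_fst]) auto
  have sets_\<nu>: "sets \<nu> = sets (borel_on X \<Otimes>\<^sub>M borel_on \<Xi>)" by (simp add: \<nu>_def)
  have "finite_measure \<nu>"
    unfolding \<nu>_def using hz SP.P.prob_space_distr prob_space.finite_measure by blast
  then have "(\<lambda>(x, z). G x z) \<in> measurable (completion \<nu>) (borel_on (Rn d))"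
    using G_universally_measurable sets_\<nu> by (simp add: universally_measurable_def)
  then have "(\<lambda>w. G (fst w) (snd w) i) \<in> borel_measurable (completion \<nu>)" for i
    using borel_on_component_compose by (fastforce simp: split_beta')
  from completion_ex_borel_measurable_real[OF this]
  have "\<forall>i. \<exists>g'. g' \<in> borel_measurable \<nu> \<and> (AE w in \<nu>. G (fst w) (snd w) i = g' w)" by blast
  from choice[OF this] obtain g'
    where g'_\<nu>: "\<And>i. g' i \<in> borel_measurable \<nu>" and eq: "\<And>i. AE w in \<nu>. G (fst w) (snd w) i = g' i w"
    by blast
  have g'_meas: "g' i \<in> borel_measurable (borel_on X \<Otimes>\<^sub>M borel_on \<Xi>)" for i
    using g'_\<nu>[of i] measurable_cong_sets[OF sets_\<nu> refl] by blast
  define G' where "G' = (\<lambda>x z i. g' i (x, z))"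
  have G'_meas [measurable]: "(\<lambda>w. G' (fst w) (snd w) i) \<in> borel_measurable (borel_on X \<Otimes>\<^sub>M borel_on \<Xi>)" for i
    using g'_meas[of i] by (simp add: G'_def)
  have [measurable]: "h \<in> measurable S (borel_on X)" by (rule h)
  have hX: "h s \<in> X" if "s \<in> space S" for s
    using measurable_space[OF h that] by (simp add: space_restrict_space)
  have G'_h [measurable]: "(\<lambda>w. G' (h (fst w)) (snd w) i) \<in> borel_measurable (S \<Otimes>\<^sub>M P)" for i
    using measurable_compose[OF hz G'_meas[of i]] by simp
  have "AE w in S \<Otimes>\<^sub>M P. \<forall>i. G (h (fst w)) (snd w) i = G' (h (fst w)) (snd w) i"
    using AE_distrD[OF hz eq[unfolded \<nu>_def]] by (simp add: AE_all_countable G'_def)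
  from SP.AE_pair[OF this] have eqG: "AE s in S. AE z in P. \<forall>i. G (h s) z i = G' (h s) z i" by simp

  \<comment> \<open>The mean of the Borel version is measurable in \<open>x\<close>; it is
    identified with \<open>mean_G\<close> at \<open>h s\<close> for almost every \<open>s\<close>,
    in the coordinates below \<open>d\<close>.\<close>
  define m' where "m' = (\<lambda>x i. \<integral>z. G' x z i \<partial>P)"
  have m'_meas [measurable]: "(\<lambda>x. m' x i) \<in> borel_measurable (borel_on X)" for i
    unfolding m'_def using G'_meas[of i]
    by (intro P.borel_measurable_lebesgue_integral) (simp add: split_beta')
  define e where "e = (\<lambda>w. pnorm d p (vdiff (G' (fst w) (snd w)) (m' (fst w))))"
  have e_meas [measurable]: "e \<in> borel_measurable (borel_on X \<Otimes>\<^sub>M P)"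
    unfolding e_def by measurable

  have mean: "AE s in S. (\<forall>i<d. m' (h s) i = mean_G (h s) i) \<and> (\<integral>\<^sup>+z. ennreal ((e (h s, z))\<^sup>2) \<partial>P) \<le> ennreal (\<sigma>\<^sup>2)"
    using eqG AE_space
  proof eventually_elim
    case (elim s)
    note x = hX[OF elim(2)]
    have sec [measurable]: "(\<lambda>z. G' (h s) z i) \<in> borel_measurable (borel_on \<Xi>)" for i
    proof -
      have "(\<lambda>z. (h s, z)) \<in> measurable (borel_on \<Xi>) (borel_on X \<Otimes>\<^sub>M borel_on \<Xi>)"
        using x by (intro measurable_Pair measurable_const) (auto simp: space_restrict_space)
      from measurable_compose[OF this G'_meas[of i]] show ?thesis by simp
    qed
    have eqM: "AE \<omega> in M. \<forall>i. G (h s) (\<xi> \<omega>) i = G' (h s) (\<xi> \<omega>) i"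
      using AE_distrD[OF \<xi>_rv elim(1)] .
    have m: "m' (h s) i = mean_G (h s) i" if "i < d" for i
    proof -
      have "m' (h s) i = (\<integral>\<omega>. G' (h s) (\<xi> \<omega>) i \<partial>M)"
        unfolding m'_def by (rule integral_distr[OF \<xi>_rv sec])
      also have "\<dots> = mean_G (h s) i"
        unfolding mean_G_def
      proof (rule integral_cong_AE)
        show "(\<lambda>\<omega>. G' (h s) (\<xi> \<omega>) i) \<in> borel_measurable M" using measurable_compose[OF \<xi>_rv sec] .
        show "(\<lambda>\<omega>. G (h s) (\<xi> \<omega>) i) \<in> borel_measurable M"
          using var x that by (auto simp: bounded_variance_def)
        show "AE \<omega> in M. G' (h s) (\<xi> \<omega>) i = G (h s) (\<xi> \<omega>) i"
          using eqM by eventually_elim simp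
      qed
      finally show ?thesis .
    qed
    have e_sec: "(\<lambda>z. e (h s, z)) \<in> borel_measurable (borel_on \<Xi>)"
      unfolding e_def by simp
    have "(\<integral>\<^sup>+z. ennreal ((e (h s, z))\<^sup>2) \<partial>P) = (\<integral>\<^sup>+\<omega>. ennreal ((e (h s, \<xi> \<omega>))\<^sup>2) \<partial>M)"
      using measurable_compose[OF borel_measurable_power[OF e_sec] measurable_ennreal]
      by (intro nn_integral_distr \<xi>_rv) simp
    also have "\<dots> = (\<integral>\<^sup>+\<omega>. ennreal ((pnorm d p (vdiff (G (h s) (\<xi> \<omega>)) (mean_G (h s))))\<^sup>2) \<partial>M)"
    proof (rule nn_integral_cong_AE)
      show "AE \<omega> in M. ennreal ((e (h s, \<xi> \<omega>))\<^sup>2) = ennreal ((pnorm d p (vdiff (G (h s) (\<xi> \<omega>)) (mean_G (h s))))\<^sup>2)"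
        using eqM
      proof eventually_elim
        case (elim \<omega>)
        have "e (h s, \<xi> \<omega>) = pnorm d p (vdiff (G (h s) (\<xi> \<omega>)) (mean_G (h s)))"
          unfolding e_def using elim m by (intro pnorm_cong) (simp add: vdiff_def)
        then show ?case by simp
      qed
    qed
    also have "\<dots> \<le> ennreal (\<sigma>\<^sup>2)"
      using var x by (simp add: bounded_variance_def mean_G_def)
    finally show ?case using m by simp
  qed

  have fB: "(\<lambda>w. f (h (fst w)) (snd w)) \<in> borel_measurable (S \<Otimes>\<^sub>M P)"
  proof -
    have "h \<in> measurable S (borel_on B)"
      using h X_subset by (intro measurable_restrict_space2) (auto simp: measurable_restrict_space2_iff hX)
    then have "(\<lambda>w. (h (fst w), snd w)) \<in> measurable (S \<Otimes>\<^sub>M P) (borel_on B \<Otimes>\<^sub>M borel_on \<Xi>)"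
      by (intro measurable_Pair measurable_compose[OF measurable_fst]) auto
    from measurable_compose[OF this f_measurable] show ?thesis by simp
  qed
  have "AE w in S \<Otimes>\<^sub>M P. f (h (fst w)) (snd w) + dot d (G' (h (fst w)) (snd w)) (vdiff v (h (fst w))) \<le> f v (snd w)"
    if v: "v \<in> rational_points B" for v
  \<comment> \<open>For fixed \<open>v\<close> the set in question is measurable because
    \<open>G'\<close> is Borel. Hence \<open>s\<close> may be frozen, and \<open>h s\<close> is then
    a deterministic point of \<open>X\<close>, where the subgradient property of \<open>G\<close> is
    given.\<close>
  proof (rule SP.AE_pair_measure)
    have vB: "v \<in> B" using v by (simp add: rational_points_def)
    have [measurable]: "(\<lambda>w. f v (snd w)) \<in> borel_measurable (S \<Otimes>\<^sub>M P)"
      using measurable_compose[OF measurable_snd f_section_measurable[OF vB], of S] by simp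
    note [measurable] = fB
    have "(\<lambda>w. vdiff v (h (fst w)) i) \<in> borel_measurable (S \<Otimes>\<^sub>M P)" for i
      unfolding vdiff_def by measurable
    note [measurable] = this
    show "{w \<in> space (S \<Otimes>\<^sub>M P). f (h (fst w)) (snd w) + dot d (G' (h (fst w)) (snd w)) (vdiff v (h (fst w))) \<le> f v (snd w)}
      \<in> sets (S \<Otimes>\<^sub>M P)"
      by measurable
    show "AE s in S. AE z in P. f (h (fst (s, z))) (snd (s, z)) + dot d (G' (h (fst (s, z))) (snd (s, z))) (vdiff v (h (fst (s, z)))) \<le> f v (snd (s, z))"
      using eqG AE_space
    proof eventually_elim
      case (elim s)
      show ?case
        using elim(1) G_subgradient[OF hX[OF elim(2)]]
      proof eventually_elim
        case (elim z)
        then have "dot d (G' (h s) z) (vdiff v (h s)) = dot d (G (h s) z) (vdiff v (h s))"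
          by (simp add: dot_def)
        then show ?case using elim(2) vB by (simp add: subdifferential_def)
      qed
    qed
  qed
  then have rat: "AE w in S \<Otimes>\<^sub>M P. \<forall>v\<in>rational_points B.
      f (h (fst w)) (snd w) + dot d (G' (h (fst w)) (snd w)) (vdiff v (h (fst w))) \<le> f v (snd w)"
    using countable_rational_points[OF openin_subset[OF B_open]] by (subst AE_ball_countable) auto
  have conv': "AE w in S \<Otimes>\<^sub>M P. vconvex_on B (\<lambda>x. f x (snd w))"
  proof -
    \<comment> \<open>The set of observations with nonconvex \<open>f\<close> may fail to be
      measurable and is enclosed in a measurable null set.\<close>
    from conv obtain Z where Z: "Z \<in> null_sets P" "{z \<in> space P. \<not> vconvex_on B (\<lambda>x. f x z)} \<subseteq> Z"
      by (auto simp: eventually_ae_filter)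
    have [measurable]: "Z \<in> sets P" using Z by auto
    have "AE w in S \<Otimes>\<^sub>M P. snd w \<notin> Z"
    proof (rule SP.AE_pair_measure)
      show "{w \<in> space (S \<Otimes>\<^sub>M P). snd w \<notin> Z} \<in> sets (S \<Otimes>\<^sub>M P)" by measurable
      show "AE s in S. AE z in P. snd (s, z) \<notin> Z" using AE_not_in[OF Z(1)] by simp
    qed
    then show ?thesis
      using AE_space by eventually_elim (use Z(2) in \<open>auto simp: space_pair_measure\<close>)
  qed
  have "AE w in S \<Otimes>\<^sub>M P. \<forall>i<d. m' (h (fst w)) i = mean_G (h (fst w)) i"
  proof -
    have "AE s in S. \<forall>i<d. m' (h s) i = mean_G (h s) i" using mean by eventually_elim simp
    then have "AE s in distr (S \<Otimes>\<^sub>M P) S fst. \<forall>i<d. m' (h s) i = mean_G (h s) i"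
      by (simp only: P.distr_pair_fst)
    from AE_distrD[OF measurable_fst this] show ?thesis .
  qed
  with rat conv' have final: "AE w in S \<Otimes>\<^sub>M P. \<forall>y\<in>B. f (h (fst w)) (snd w) + dot d (mean_G (h (fst w))) (vdiff y (h (fst w)))
      - e (h (fst w), snd w) * pnorm d q (vdiff y (h (fst w))) \<le> f y (snd w)"
  proof eventually_elim
    case (elim w)
    define x z where "x = h (fst w)" and "z = snd w"
    show ?case
    proof
      fix y assume y: "y \<in> B"
      have 1: "f x z + dot d (G' x z) (vdiff y x) \<le> f y z"
        unfolding x_def z_def
        using subgradient_from_rational_points[OF B_open elim(2) _ y, of "f (h (fst w)) (snd w)"] elim(1) by blast
      have "dot d (mean_G x) (vdiff y x) - dot d (G' x z) (vdiff y x) \<le> \<bar>dot d (vdiff (G' x z) (mean_G x)) (vdiff y x)\<bar>"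
        by (simp add: dot_diff_left)
      also have "\<dots> \<le> pnorm d (q / (q - 1)) (vdiff (G' x z) (mean_G x)) * pnorm d q (vdiff y x)"
        by (rule abs_dot_le_pnorm[OF q])
      \<comment> \<open>Here \<open>p \<le> q / (q - 1)\<close> enters: the dual norm is at most the
        \<open>p\<close>-norm.\<close>
      also have "\<dots> \<le> pnorm d p (vdiff (G' x z) (mean_G x)) * pnorm d q (vdiff y x)"
        using p by (intro mult_right_mono pnorm_mono_exponent) auto
      also have "pnorm d p (vdiff (G' x z) (mean_G x)) = e (x, z)"
        unfolding e_def using elim(3) by (intro pnorm_cong) (simp add: vdiff_def x_def)
      finally show "f (h (fst w)) (snd w) + dot d (mean_G (h (fst w))) (vdiff y (h (fst w)))
          - e (h (fst w), snd w) * pnorm d q (vdiff y (h (fst w))) \<le> f y (snd w)"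
        using 1 by (simp add: x_def z_def)
    qed
  qed
  show ?thesis
  proof
    show "AE s in S. (\<integral>\<^sup>+z. ennreal ((e (h s, z))\<^sup>2) \<partial>P) \<le> ennreal (\<sigma>\<^sup>2)"
      using mean by eventually_elim simp
    show "\<forall>w. 0 \<le> e w" by (simp add: e_def)
  qed (fact e_meas final)+
qed

text \<open>Passing through the gradients \<open>D1\<close> splits the difference into a Lipschitz
  part and two residuals, each of dual norm at most \<open>K\<close> because \<open>mean_G\<close>
  is a subgradient of the objective.\<close>

lemma composite_mono:
  assumes comp: "composite_structure d (objective_dom M \<xi> f B) X (objective M \<xi> f) q L K"
    and var: "bounded_variance M d \<xi> X G p \<sigma>" and q: "1 < q" and xy: "x \<in> X" "y \<in> X"
  shows "dot d (vdiff (mean_G x) (mean_G y)) (vdiff x y)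
    \<le> L * (pnorm d q (vdiff x y))\<^sup>2 + 2 * K * pnorm d q (vdiff x y)"
proof -
  obtain D1 where lip: "pnorm d (q / (q - 1)) (vdiff (D1 x) (D1 y)) \<le> L * pnorm d q (vdiff x y)"
    and bdd: "\<And>u. u \<in> X \<Longrightarrow> pnorm d (q / (q - 1)) (vdiff (mean_G u) (D1 u)) \<le> K"
    using comp mean_G_subgradient[OF _ var] xy unfolding composite_structure_def by metis
  define t where "t = pnorm d q (vdiff x y)"
  have b: "\<bar>dot d (vdiff (mean_G u) (D1 u)) (vdiff x y)\<bar> \<le> K * t" if "u \<in> X" for u
    unfolding t_def using order.trans[OF abs_dot_le_pnorm[OF q] mult_right_mono[OF bdd[OF that] pnorm_nonneg]] .
  have "dot d (vdiff (D1 x) (D1 y)) (vdiff x y) \<le> L * t * t"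
    unfolding t_def using order.trans[OF dot_le_pnorm[OF q] mult_right_mono[OF lip pnorm_nonneg]] .
  then show ?thesis
    using b[OF xy(1)] b[OF xy(2)] unfolding dot_diff_left t_def[symmetric]
    by (simp add: power2_eq_square abs_le_iff)
qed

end

text \<open>Connects the stochastic program with the abstract stability locale. The noise bound is
  taken along the approximate solution, and once more along the constant map with value
  \<open>xs\<close>.\<close>

lemma saa_stability_approx_solution:
  assumes sp: "stochastic_program M d m \<Xi> \<xi> B X f G"
    and xs: "xs \<in> X" "\<And>x. x \<in> X \<Longrightarrow> objective M \<xi> f xs \<le> objective M \<xi> f x"
    and N: "N \<ge> 1" and q: "1 < q" "1 < q'" "q' \<le> 2" "q' \<le> q"
    and lam: "0 < lam" and L: "1 \<le> L" "L \<le> lam * (q' - 1) / 4 * real N" and K: "1 \<le> K"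
    and comp: "composite_structure d (objective_dom M \<xi> f B) X (objective M \<xi> f) q L K"
    and p: "1 \<le> p" "p \<le> q / (q - 1)" and var: "bounded_variance M d \<xi> X G p \<sigma>"
    and conv: "AE z in distr M (borel_on \<Xi>) \<xi>. vconvex_on B (\<lambda>x. f x z)"
    and \<delta>: "0 \<le> \<delta>" "\<delta> \<le> 1 / real N"
    and approx: "approx_solution d \<Xi> (distr M (borel_on \<Xi>) \<xi>) B X f q' x0 lam N \<delta> q xt"
  shows "\<exists>g e es c. saa_stability (distr M (borel_on \<Xi>) \<xi>) d N X f
    (\<lambda>x. \<integral>z. f x z \<partial>distr M (borel_on \<Xi>) \<xi>) (reg_V d q' x0) g xt e es xs q \<delta> (lam * (q' - 1) / 4) lam L K c \<sigma>"
proof -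
  interpret stochastic_program M d m \<Xi> \<xi> B X f G by fact
  interpret P: prob_space P by (rule prob_space_P)
  define SP where "SP = (\<Pi>\<^sub>M j\<in>{1..N}. P)"
  interpret SP: prob_space SP unfolding SP_def by (intro prob_space_PiM prob_space_P)
  interpret Q: pair_prob_space SP P ..
  have "sets SP = sets (\<Pi>\<^sub>M j\<in>{1..N}. borel_on \<Xi>)"
    unfolding SP_def by (intro sets_PiM_cong) auto
  then have xt [measurable]: "xt \<in> measurable SP (borel_on X)"
    using approx measurable_cong_sets[of SP _ "borel_on X" "borel_on X"] by (auto simp: approx_solution_def)
  have xsX: "(\<lambda>_. xs) \<in> measurable P (borel_on X)"
    using xs by (intro measurable_const) (simp add: space_restrict_space)
  obtain e where e [measurable]: "e \<in> borel_measurable (borel_on X \<Otimes>\<^sub>M P)" and e0: "\<forall>w. 0 \<le> e w"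
    and e2: "AE s in SP. (\<integral>\<^sup>+z. ennreal ((e (xt s, z))\<^sup>2) \<partial>P) \<le> ennreal (\<sigma>\<^sup>2)"
    and e_sub: "AE w in SP \<Otimes>\<^sub>M P. \<forall>y\<in>B. f (xt (fst w)) (snd w) + dot d (mean_G (xt (fst w))) (vdiff y (xt (fst w)))
      - e (xt (fst w), snd w) * pnorm d q (vdiff y (xt (fst w))) \<le> f y (snd w)"
    by (rule noise_bound[OF SP.prob_space_axioms xt conv var p q(1)])
  obtain es where es [measurable]: "es \<in> borel_measurable (borel_on X \<Otimes>\<^sub>M P)" and "\<forall>w. 0 \<le> es w"
    and es2: "AE s in P. (\<integral>\<^sup>+z. ennreal ((es (xs, z))\<^sup>2) \<partial>P) \<le> ennreal (\<sigma>\<^sup>2)"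
    and es_sub: "AE w in P \<Otimes>\<^sub>M P. \<forall>y\<in>B. f xs (snd w) + dot d (mean_G xs) (vdiff y xs)
      - es (xs, snd w) * pnorm d q (vdiff y xs) \<le> f y (snd w)"
    by (rule noise_bound[OF prob_space_P xsX conv var p q(1)])
  define c where "c = pnorm d (q / (q - 1)) (mean_G xs)"
  have obj: "objective M \<xi> f x = (\<integral>z. f x z \<partial>P)" if "x \<in> X" for x
    using objective_eq that X_subset by blast
  have mono: "dot d (vdiff (mean_G x) (mean_G y)) (vdiff x y)
    \<le> L * (pnorm d q (vdiff x y))\<^sup>2 + 2 * K * pnorm d q (vdiff x y)" if "x \<in> X" "y \<in> X" for x y
    using composite_mono[OF comp var q(1) that] .
  have "saa_stability P d N X f (\<lambda>x. \<integral>z. f x z \<partial>P) (reg_V d q' x0) mean_G xt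
    (\<lambda>w. e (xt (fst w), snd w)) (\<lambda>z. es (xs, z)) xs q \<delta> (lam * (q' - 1) / 4) lam L K c \<sigma>"
  proof (unfold_locales, unfold SP_def[symmetric])
    show "(\<lambda>(x, z). f x z) \<in> borel_measurable (borel_on X \<Otimes>\<^sub>M P)"
      by (rule f_X_measurable)
    show "integrable P (f x)" if "x \<in> X" for x
      using integrable_P_iff[of x] f_integrable[OF that] that X_subset by auto
    show "reg_V d q' x0 \<in> borel_measurable (borel_on X)"
      unfolding reg_V_def[abs_def] by measurable
    show "0 \<le> reg_V d q' x0 x" for x by (simp add: reg_V_def)
    show "xt \<in> measurable SP (borel_on X)" by (rule xt)
    show "AE s in SP. \<forall>y\<in>X. (\<Sum>j=1..N. f (xt s) (s j)) / real N + lam * reg_V d q' x0 (xt s)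
        - \<delta> * pnorm d q (vdiff y (xt s)) + lam * (q' - 1) / 4 * (pnorm d q (vdiff y (xt s)))\<^sup>2
        \<le> (\<Sum>j=1..N. f y (s j)) / real N + lam * reg_V d q' x0 y"
    proof -
      have comp_conv: "AE s in SP. \<forall>j\<in>{1..N}. vconvex_on B (\<lambda>x. f x (s j))"
        unfolding SP_def
        by (intro AE_finite_allI AE_PiM_component prob_space_P conv) auto
      have "AE s in SP. \<exists>g\<in>subdifferential d B (F_reg d f q' x0 lam N s) (xt s).
          \<forall>x\<in>X. dot d g (vdiff x (xt s)) \<ge> - \<delta> * pnorm d q (vdiff x (xt s))"
        using approx unfolding approx_solution_def SP_def by (rule conjunct2)
      with comp_conv show ?thesis
      proof eventually_elim
        case (elim s)
        then obtain g where g: "g \<in> subdifferential d B (F_reg d f q' x0 lam N s) (xt s)"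
          "\<And>x. x \<in> X \<Longrightarrow> dot d g (vdiff x (xt s)) \<ge> - \<delta> * pnorm d q (vdiff x (xt s))" by blast
        show ?case
          using F_reg_strong_convexity[OF q(2-4) less_imp_le[OF lam] N B_convex _ g(1) _ g(2)] elim(1) X_subset
          by (auto simp: F_reg_def)
      qed
    qed
    show "(\<lambda>w. e (xt (fst w), snd w)) \<in> borel_measurable (SP \<Otimes>\<^sub>M P)" by measurable
    show "(\<integral>\<^sup>+w. ennreal ((e (xt (fst w), snd w))\<^sup>2) \<partial>(SP \<Otimes>\<^sub>M P)) \<le> ennreal (\<sigma>\<^sup>2)"
    proof -
      have "(\<integral>\<^sup>+w. ennreal ((e (xt (fst w), snd w))\<^sup>2) \<partial>(SP \<Otimes>\<^sub>M P)) = (\<integral>\<^sup>+s. (\<integral>\<^sup>+z. ennreal ((e (xt s, z))\<^sup>2) \<partial>P) \<partial>SP)"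
        by (subst P.nn_integral_fst[symmetric]) auto
      also have "\<dots> \<le> (\<integral>\<^sup>+s. ennreal (\<sigma>\<^sup>2) \<partial>SP)" using e2 by (rule nn_integral_mono_AE)
      also have "\<dots> = ennreal (\<sigma>\<^sup>2)" by (simp add: SP.emeasure_space_1)
      finally show ?thesis .
    qed
    show "AE w in SP \<Otimes>\<^sub>M P. \<forall>y\<in>X. f (xt (fst w)) (snd w) + dot d (mean_G (xt (fst w))) (vdiff y (xt (fst w)))
        - e (xt (fst w), snd w) * pnorm d q (vdiff y (xt (fst w))) \<le> f y (snd w)"
      using e_sub by eventually_elim (use X_subset in blast)
    show "square_integrable P (\<lambda>z. es (xs, z))"
    proof (rule square_integrable_nn_integral(1))
      have "(\<lambda>z. (xs, z)) \<in> measurable P (borel_on X \<Otimes>\<^sub>M P)" using xsX by (intro measurable_Pair) auto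
      from measurable_compose[OF this es] show "(\<lambda>z. es (xs, z)) \<in> borel_measurable P" .
      show "(\<integral>\<^sup>+z. ennreal ((es (xs, z))\<^sup>2) \<partial>P) \<le> ennreal (\<sigma>\<^sup>2)" using es2 by simp
    qed simp
    show "AE z in P. \<forall>y\<in>X. f xs z - (c + es (xs, z)) * pnorm d q (vdiff y xs) \<le> f y z"
    proof -
      interpret PP: pair_prob_space P P ..
      have "AE s in P. AE z in P. \<forall>y\<in>B. f xs z + dot d (mean_G xs) (vdiff y xs) - es (xs, z) * pnorm d q (vdiff y xs) \<le> f y z"
        using PP.AE_pair[OF es_sub] by simp
      then have "AE z in P. \<forall>y\<in>B. f xs z + dot d (mean_G xs) (vdiff y xs) - es (xs, z) * pnorm d q (vdiff y xs) \<le> f y z"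
        by simp
      then show ?thesis
      proof eventually_elim
        case (elim z)
        show ?case
        proof
          fix y assume "y \<in> X"
          then have "f xs z + dot d (mean_G xs) (vdiff y xs) - es (xs, z) * pnorm d q (vdiff y xs) \<le> f y z"
            using elim X_subset by blast
          moreover have "\<bar>dot d (mean_G xs) (vdiff y xs)\<bar> \<le> c * pnorm d q (vdiff y xs)"
            unfolding c_def by (rule abs_dot_le_pnorm[OF q(1)])
          ultimately show "f xs z - (c + es (xs, z)) * pnorm d q (vdiff y xs) \<le> f y z"
            by (simp add: algebra_simps)
        qed
      qed
    qed
    show "(\<integral>z. f xs z \<partial>P) \<le> (\<integral>z. f x z \<partial>P)" if "x \<in> X" for x
      using xs(2)[OF that] obj that xs(1) by simp
    show "(\<integral>z. f x z \<partial>P) - (\<integral>z. f xs z \<partial>P) \<le> L * (pnorm d q (vdiff x xs))\<^sup>2 + (2 * K + c) * pnorm d q (vdiff x xs)"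
      if x: "x \<in> X" for x
    proof -
      have "xs \<in> objective_dom M \<xi> f B"
        using xs(1) X_subset f_integrable by (auto simp: objective_dom_def)
      \<comment> \<open>The subgradient at \<open>x\<close> bounds the increase from
        \<open>xs\<close>, and its difference from the subgradient at \<open>xs\<close> is
        controlled by \<open>composite_mono\<close>.\<close>
      then have "objective M \<xi> f x + dot d (mean_G x) (vdiff xs x) \<le> objective M \<xi> f xs"
        using mean_G_subgradient[OF x var] by (auto simp: subdifferential_def)
      then have "(\<integral>z. f x z \<partial>P) - (\<integral>z. f xs z \<partial>P) \<le> dot d (mean_G x) (vdiff x xs)"
        using obj x xs(1) dot_vdiff_minus[of d "mean_G x" xs x] by simp
      also have "\<dots> = dot d (vdiff (mean_G x) (mean_G xs)) (vdiff x xs) + dot d (mean_G xs) (vdiff x xs)"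
        by (simp add: dot_diff_left)
      also have "\<dots> \<le> (L * (pnorm d q (vdiff x xs))\<^sup>2 + 2 * K * pnorm d q (vdiff x xs)) + c * pnorm d q (vdiff x xs)"
        unfolding c_def by (intro add_mono mono x xs(1) dot_le_pnorm q(1))
      finally show ?thesis by (simp add: algebra_simps)
    qed
  qed (use N \<delta> lam L K q xs(1) e0 mono in \<open>auto simp: c_def\<close>)
  then show ?thesis by blast
qed

section \<open>Sample size guarantees\<close>

lemma law_transfer:
  fixes gap :: "'a \<Rightarrow> real"
  assumes X: "X \<in> measurable M N" "distr M N X = N" and h: "h \<in> borel_measurable N"
    and gap: "\<And>\<omega>. \<omega> \<in> space M \<Longrightarrow> gap \<omega> = h (X \<omega>)"
  shows "integrable M gap \<longleftrightarrow> integrable N h"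
    and "(\<integral>\<omega>. gap \<omega> \<partial>M) = (\<integral>s. h s \<partial>N)"
    and "\<P>(\<omega> in M. gap \<omega> \<le> a) = \<P>(s in N. h s \<le> a)"
proof -
  show "integrable M gap \<longleftrightarrow> integrable N h"
    using integrable_distr_eq[OF X(1) h] X(2) Bochner_Integration.integrable_cong[OF refl, of M gap "\<lambda>\<omega>. h (X \<omega>)"] gap by auto
  show "(\<integral>\<omega>. gap \<omega> \<partial>M) = (\<integral>s. h s \<partial>N)"
    using integral_distr[OF X(1) h] X(2) Bochner_Integration.integral_cong[OF refl, of M gap "\<lambda>\<omega>. h (X \<omega>)"] gap by auto
  have "{\<omega> \<in> space M. gap \<omega> \<le> a} = X -` {s \<in> space N. h s \<le> a} \<inter> space M"
    using measurable_space[OF X(1)] gap by auto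
  moreover have "{s \<in> space N. h s \<le> a} \<in> sets N" using h by measurable
  ultimately show "\<P>(\<omega> in M. gap \<omega> \<le> a) = \<P>(s in N. h s \<le> a)"
    using measure_distr[OF X(1), of "{s \<in> space N. h s \<le> a}"] X(2) by simp
qed

lemma subdifferential_cong:
  assumes "\<And>x. x \<in> D \<Longrightarrow> h x = h' x"
  shows "subdifferential d D h x = subdifferential d D h' x"
  using assms unfolding subdifferential_def by auto

text \<open>Two models with the same law are known to have equal objectives only on
  \<open>B\<close>, where \<open>f\<close> has measurable sections.\<close>

lemma composite_structure_cong:
  assumes "\<And>x. x \<in> D \<union> X \<Longrightarrow> F x = F' x" and "composite_structure d D X F q L K"
  shows "composite_structure d D X F' q L K"
proof -
  have "subdifferential d D F' = subdifferential d D F"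
    using subdifferential_cong[of D F' F d] assms(1) by (auto simp: fun_eq_iff)
  moreover have "(\<forall>x\<in>X. F' x = F1 x + F2 x) = (\<forall>x\<in>X. F x = F1 x + F2 x)" for F1 F2
    using assms(1) by auto
  ultimately show ?thesis using assms(2) unfolding composite_structure_def by simp
qed

text \<open>The premises of \<open>sample_size_guarantee\<close> as a locale, so that a second
  problem can be constructed inside a given one.\<close>

locale saa_problem = stochastic_program M d m \<Xi> \<xi> B X f G
  for M :: "'w measure" and d m \<Xi> \<xi> B X f G +
  fixes xs x0 :: vec and N :: nat and \<xi>s :: "nat \<Rightarrow> 'w \<Rightarrow> vec"
    and q q' \<epsilon> R lam L K p \<sigma> \<delta> :: real and xt :: "(nat \<Rightarrow> vec) \<Rightarrow> vec"
  assumes xs_X: "xs \<in> X" and xs_min: "\<forall>x\<in>X. objective M \<xi> f xs \<le> objective M \<xi> f x"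
    and x0_X: "x0 \<in> X" and N_ge: "N \<ge> 1" and iid: "iid_sample M \<Xi> \<xi> N \<xi>s"
    and q_gt: "q > 1" and \<epsilon>_pos: "0 < \<epsilon>" and \<epsilon>_le: "\<epsilon> \<le> 1"
    and q': "1 < q'" "q' \<le> 2" "q' \<le> q"
    and R_ge: "R \<ge> max 1 (reg_V d q' x0 xs)" and lam_eq: "lam = \<epsilon> / (2 * R)"
    and L_ge: "L \<ge> 1" and K_ge: "K \<ge> 1"
    and composite: "composite_structure d (objective_dom M \<xi> f B) X (objective M \<xi> f) q L K"
    and p: "1 \<le> p" "p \<le> q / (q - 1)" and \<sigma>_ge: "\<sigma> \<ge> 1"
    and variance: "bounded_variance M d \<xi> X G p \<sigma>"
    and f_convex: "AE z in distr M (borel_on \<Xi>) \<xi>. vconvex_on B (\<lambda>x. f x z)"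
    and \<delta>: "0 \<le> \<delta>" "\<delta> \<le> 1 / real N"
    and approx_sol: "approx_solution d \<Xi> (distr M (borel_on \<Xi>) \<xi>) B X f q' x0 lam N \<delta> q xt"
begin

definition SP where "SP = (\<Pi>\<^sub>M j\<in>{1..N}. P)"

abbreviation gap :: "'w \<Rightarrow> real" where
  "gap \<equiv> \<lambda>\<omega>. objective M \<xi> f (xt (sample_vector N \<xi>s \<omega>)) - objective M \<xi> f xs"

definition sample_gap :: "(nat \<Rightarrow> vec) \<Rightarrow> real" where
  "sample_gap s = (\<integral>z. f (xt s) z \<partial>P) - (\<integral>z. f xs z \<partial>P)"

lemma prob_space_SP: "prob_space SP"
  unfolding SP_def by (intro prob_space_PiM prob_space_P)

lemma sets_SP: "sets SP = sets (\<Pi>\<^sub>M j\<in>{1..N}. borel_on \<Xi>)"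
  unfolding SP_def by (intro sets_PiM_cong) auto

lemma xt_SP: "xt \<in> measurable SP (borel_on X)"
  using approx_sol measurable_cong_sets[OF sets_SP refl, of "borel_on X"]
  unfolding approx_solution_def by blast

lemma xt_X: "s \<in> space SP \<Longrightarrow> xt s \<in> X"
  using measurable_space[OF xt_SP] by (auto simp: space_restrict_space)

lemma sample_gap_measurable: "sample_gap \<in> borel_measurable SP"
proof -
  interpret P: prob_space P by (rule prob_space_P)
  have "(\<lambda>x. \<integral>z. f x z \<partial>P) \<in> borel_measurable (borel_on X)"
    by (rule P.borel_measurable_lebesgue_integral[OF f_X_measurable])
  from measurable_compose[OF xt_SP this] show ?thesis
    unfolding sample_gap_def[abs_def] by (intro borel_measurable_diff) auto
qed

lemma objective_X: "x \<in> X \<Longrightarrow> objective M \<xi> f x = (\<integral>z. f x z \<partial>P)"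
  using objective_eq X_subset by blast

lemma sample_vector_SP: "sample_vector N \<xi>s \<in> measurable M SP" "distr M SP (sample_vector N \<xi>s) = SP"
  unfolding SP_def using sample_vector_law[OF prob_space_axioms \<xi>_rv N_ge iid] by auto

lemma gap_eq:
  assumes "\<omega> \<in> space M"
  shows "gap \<omega> = sample_gap (sample_vector N \<xi>s \<omega>)"
  using objective_X xs_X xt_X[OF measurable_space[OF sample_vector_SP(1) assms]]
  by (simp add: sample_gap_def)

lemma gap_transfer:
  shows "integrable M gap \<longleftrightarrow> integrable SP sample_gap"
    and "(\<integral>\<omega>. gap \<omega> \<partial>M) = (\<integral>s. sample_gap s \<partial>SP)"
    and "\<P>(\<omega> in M. gap \<omega> \<le> a) = \<P>(s in SP. sample_gap s \<le> a)"
  by (rule law_transfer[OF sample_vector_SP sample_gap_measurable], rule gap_eq, assumption)+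

lemma R_pos: "R \<ge> 1" "reg_V d q' x0 xs \<le> R"
  using R_ge by auto

lemma lam_pos: "0 < lam"
  using lam_eq \<epsilon>_pos R_pos by simp

text \<open>The expectation bound is the case \<open>\<beta> = 1\<close>. The constant is
  \<open>528 = 33 * 8 * 2\<close>: 33 from \<open>expected_regularized_objective\<close>, 8 from
  \<open>\<kappa> = \<epsilon> * (q' - 1) / (8 * R)\<close>, and 2 because the bias takes half of
  \<open>\<epsilon>\<close>.\<close>

lemma gap_bounds:
  assumes \<beta>: "0 < \<beta>" "\<beta> \<le> 1"
    and size: "real N \<ge> 528 * R / (q' - 1) * max (L / \<epsilon>) ((\<sigma>\<^sup>2 + K\<^sup>2) / (\<beta> * \<epsilon>\<^sup>2))"
  shows "integrable M gap" "(\<integral>\<omega>. gap \<omega> \<partial>M) \<le> \<epsilon>" "\<P>(\<omega> in M. gap \<omega> \<le> \<epsilon>) \<ge> 1 - \<beta>"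
proof -
  define \<kappa> where "\<kappa> = lam * (q' - 1) / 4"
  have \<kappa>: "\<kappa> = \<epsilon> * (q' - 1) / (8 * R)" "0 < \<kappa>"
    using lam_eq \<epsilon>_pos R_pos(1) q' by (auto simp: \<kappa>_def)
  have pos: "0 < R" "0 < q' - 1" "0 < \<kappa> * real N" using R_pos q' \<kappa>(2) N_ge by simp_all
  have "528 * R / (q' - 1) * (L / \<epsilon>) \<le> real N"
    using size pos by (smt (verit) divide_nonneg_nonneg max.cobounded1 mult_left_mono)
  then have "528 * (R * L) \<le> real N * ((q' - 1) * \<epsilon>)"
    using pos \<epsilon>_pos by (simp add: field_simps)
  moreover have "0 \<le> R * L" using pos L_ge by simp
  \<comment> \<open>Absorbing the smooth part takes just the factor 8 of
    \<open>\<kappa>\<close>.\<close>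
  ultimately have "8 * (R * L) \<le> real N * ((q' - 1) * \<epsilon>)" by linarith
  then have "L \<le> \<kappa> * real N"
    using pos by (simp add: \<kappa>(1) field_simps)
  then obtain g e es c where "saa_stability P d N X f (\<lambda>x. \<integral>z. f x z \<partial>P) (reg_V d q' x0) g xt e es xs q \<delta> \<kappa> lam L K c \<sigma>"
    using saa_stability_approx_solution[OF stochastic_program_axioms xs_X _ N_ge q_gt q' lam_pos L_ge _ K_ge
        composite p variance f_convex \<delta> approx_sol] xs_min
    unfolding \<kappa>_def by blast
  then interpret S: saa_stability P d N X f "\<lambda>x. \<integral>z. f x z \<partial>P" "reg_V d q' x0" g xt e es xs q \<delta> \<kappa> lam L K c \<sigma> .
  interpret SP: prob_space SP by (rule prob_space_SP)
  define F where "F = (\<lambda>x. \<integral>z. f x z \<partial>P)"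
  define H where "H = (\<lambda>x. F x + lam * reg_V d q' x0 x)"
  define I where "I = Inf (H ` X)"
  have Fi: "integrable SP (\<lambda>s. F (xt s))" and Vi: "integrable SP (\<lambda>s. reg_V d q' x0 (xt s))"
    using S.F_xt_integrable S.V_xt_integrable by (auto simp: F_def SP_def)
  have Hi: "integrable SP (\<lambda>s. H (xt s))" unfolding H_def using Fi Vi by simp
  have V0: "0 \<le> lam * reg_V d q' x0 x" for x using lam_pos by (simp add: reg_V_def)
  have bdd: "bdd_below (H ` X)"
    using S.xs(2) V0 by (intro bdd_belowI[of _ "F xs"]) (force simp: H_def F_def intro: add_increasing2)
  have "528 * R / (q' - 1) * ((\<sigma>\<^sup>2 + K\<^sup>2) / (\<beta> * \<epsilon>\<^sup>2)) \<le> real N"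
    using size pos by (smt (verit) divide_nonneg_nonneg max.cobounded2 mult_left_mono)
  then have "528 * (R * (\<sigma>\<^sup>2 + K\<^sup>2)) \<le> real N * ((q' - 1) * (\<beta> * \<epsilon>\<^sup>2))"
    using pos \<epsilon>_pos \<beta> by (simp add: divide_le_eq mult.assoc mult.left_commute)
  then have \<eta>: "33 * (K\<^sup>2 + \<sigma>\<^sup>2) / (\<kappa> * real N) \<le> \<beta> * \<epsilon> / 2"
    using pos \<epsilon>_pos N_ge by (simp add: \<kappa>(1) field_simps power2_eq_square)
  have EH: "(\<integral>s. H (xt s) \<partial>SP) \<le> H u + \<beta> * \<epsilon> / 2" if "u \<in> X" for u
    using S.expected_regularized_objective[OF that] \<eta> unfolding H_def F_def SP_def by linarith
  \<comment> \<open>The left side does not involve \<open>u\<close>, so the bound passes to the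
    infimum, whether or not it is attained.\<close>
  have "(\<integral>s. H (xt s) \<partial>SP) - \<beta> * \<epsilon> / 2 \<le> I"
    unfolding I_def using X_nonempty EH by (intro cINF_greatest) (auto simp: algebra_simps)
  then have EY: "(\<integral>s. H (xt s) - I \<partial>SP) \<le> \<beta> * \<epsilon> / 2"
    using Hi by (simp add: SP.prob_space)
  have sg: "sample_gap s = F (xt s) - F xs" for s by (simp add: sample_gap_def F_def)
  have sgi: "integrable SP sample_gap" unfolding sg[abs_def] using Fi by simp
  then show "integrable M gap" using gap_transfer(1) by blast
  have Hxs: "H xs \<le> F xs + \<epsilon> / 2"
  proof -
    have "lam * reg_V d q' x0 xs \<le> lam * R" using lam_pos R_pos by (intro mult_left_mono) auto
    also have "lam * R = \<epsilon> / 2" using lam_eq pos by simp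
    finally show ?thesis by (simp add: H_def)
  qed
  have "(\<integral>\<omega>. gap \<omega> \<partial>M) = (\<integral>s. F (xt s) \<partial>SP) - F xs"
    using gap_transfer(2) Fi by (simp add: sg SP.prob_space)
  also have "(\<integral>s. F (xt s) \<partial>SP) \<le> (\<integral>s. H (xt s) \<partial>SP)"
    using Fi Hi V0 by (intro integral_mono) (auto simp: H_def)
  also have "\<dots> \<le> H xs + \<beta> * \<epsilon> / 2" by (rule EH[OF xs_X])
  also have "H xs + \<beta> * \<epsilon> / 2 - F xs \<le> \<epsilon> / 2 + \<beta> * \<epsilon> / 2" using Hxs by simp
  also have "\<dots> \<le> \<epsilon>"
  proof -
    have "\<beta> * \<epsilon> \<le> 1 * \<epsilon>" using \<beta> \<epsilon>_pos by (intro mult_right_mono) auto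
    then show ?thesis by linarith
  qed
  finally show "(\<integral>\<omega>. gap \<omega> \<partial>M) \<le> \<epsilon>" by simp
  have I_le: "I \<le> H x" if "x \<in> X" for x unfolding I_def using bdd that by (intro cINF_lower)
  \<comment> \<open>The threshold \<open>\<epsilon> / 2\<close> is the bound
    \<open>\<beta> * \<epsilon> / 2\<close> on the expectation divided by \<open>\<beta>\<close>, so
    Markov's inequality gives exactly \<open>\<beta>\<close>.\<close>
  define bad where "bad = {s \<in> space SP. \<epsilon> / 2 \<le> H (xt s) - I}"
  have Yi: "integrable SP (\<lambda>s. H (xt s) - I)" using Hi by simp
  have bad: "bad \<in> sets SP" unfolding bad_def using Yi by measurable
  have "measure SP bad \<le> (\<integral>s. H (xt s) - I \<partial>SP) / (\<epsilon> / 2)"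
    unfolding bad_def using xt_X I_le \<epsilon>_pos Yi
    by (intro integral_Markov_inequality_measure[where A="{}"]) (auto intro: AE_I2)
  also have "\<dots> \<le> (\<beta> * \<epsilon> / 2) / (\<epsilon> / 2)" using EY \<epsilon>_pos by (intro divide_right_mono) auto
  also have "\<dots> = \<beta>" using \<epsilon>_pos by simp
  finally have "measure SP (space SP - bad) \<ge> 1 - \<beta>" using SP.prob_compl[OF bad] by simp
  also have "measure SP (space SP - bad) \<le> measure SP {s \<in> space SP. sample_gap s \<le> \<epsilon>}"
  proof (rule SP.finite_measure_mono)
    show "{s \<in> space SP. sample_gap s \<le> \<epsilon>} \<in> sets SP" using sample_gap_measurable by measurable
    show "space SP - bad \<subseteq> {s \<in> space SP. sample_gap s \<le> \<epsilon>}"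
    proof
      fix s assume s: "s \<in> space SP - bad"
      then have "H (xt s) < I + \<epsilon> / 2" by (auto simp: bad_def)
      \<comment> \<open>The bias is paid deterministically, on the good event.\<close>
      also have "I \<le> F xs + \<epsilon> / 2" using I_le[OF xs_X] Hxs by simp
      finally have "F (xt s) \<le> F xs + \<epsilon>" using V0[of "xt s"] by (simp add: H_def)
      then show "s \<in> {s \<in> space SP. sample_gap s \<le> \<epsilon>}" using s by (simp add: sg)
    qed
  qed
  finally show "\<P>(\<omega> in M. gap \<omega> \<le> \<epsilon>) \<ge> 1 - \<beta>" by (simp add: gap_transfer(3))
qed

text \<open>The canonical model: the samples are the coordinate projections on the completed product
  space. No independence of \<open>\<xi>\<close> from the samples is required, so \<open>\<xi>\<close> may be the first sample.\<close>

abbreviation "CM \<equiv> completion SP"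
abbreviation "cxi \<equiv> (\<lambda>s. s 1) :: (nat \<Rightarrow> vec) \<Rightarrow> vec"
abbreviation "cxis \<equiv> (\<lambda>j s. s j) :: nat \<Rightarrow> (nat \<Rightarrow> vec) \<Rightarrow> vec"

lemma coordinate:
  assumes "j \<in> {1..N}"
  shows "(\<lambda>s. s j) \<in> measurable CM (borel_on \<Xi>)" "distr CM (borel_on \<Xi>) (\<lambda>s. s j) = P"
proof -
  have 1: "(\<lambda>s. s j) \<in> measurable SP (borel_on \<Xi>)"
    using measurable_component_singleton[OF assms, of "\<lambda>_. P"] by (simp add: SP_def)
  then show "(\<lambda>s. s j) \<in> measurable CM (borel_on \<Xi>)" by (rule measurable_completion)
  have "distr CM (borel_on \<Xi>) (\<lambda>s. s j) = distr SP P (\<lambda>s. s j)"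
    unfolding distr_completion[OF 1] by (intro distr_cong) auto
  also have "\<dots> = P" unfolding SP_def by (intro distr_PiM_component prob_space_P assms)
  finally show "distr CM (borel_on \<Xi>) (\<lambda>s. s j) = P" .
qed

lemma cxi: "cxi \<in> measurable CM (borel_on \<Xi>)" "distr CM (borel_on \<Xi>) cxi = P"
  using coordinate[of 1] N_ge by auto

lemma complete_CM: "complete_measure CM"
  by (rule completion.complete_measure_axioms)

lemma cxi_integral:
  assumes "x \<in> B"
  shows "integrable CM (\<lambda>s. f x (cxi s)) \<longleftrightarrow> integrable M (\<lambda>\<omega>. f x (\<xi> \<omega>))"
    and "objective CM cxi f x = objective M \<xi> f x"
proof -
  show "integrable CM (\<lambda>s. f x (cxi s)) \<longleftrightarrow> integrable M (\<lambda>\<omega>. f x (\<xi> \<omega>))"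
    using integrable_distr_eq[OF cxi(1) f_section_measurable[OF assms]] integrable_P_iff[OF assms] cxi(2) by simp
  show "objective CM cxi f x = objective M \<xi> f x"
    using integral_distr[OF cxi(1) f_section_measurable[OF assms]] objective_eq[OF assms] cxi(2)
    by (simp add: objective_def)
qed

lemma objective_dom_CM: "objective_dom CM cxi f B = objective_dom M \<xi> f B"
  using cxi_integral(1) by (auto simp: objective_dom_def)

text \<open>Universal measurability is applied to the law of \<open>(x, z)\<close> with
  \<open>x\<close> fixed, a finite measure on \<open>X \<times> \<Xi>\<close>.\<close>

lemma G_section_measurable:
  assumes x: "x \<in> X"
  shows "(\<lambda>z. G x z i) \<in> borel_measurable (completion P)"
proof -
  define T where "T = borel_on X \<Otimes>\<^sub>M borel_on \<Xi>"
  have pair: "(\<lambda>z. (x, z)) \<in> measurable P T"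
    unfolding T_def using x by (intro measurable_Pair measurable_const) (auto simp: space_restrict_space)
  interpret P: prob_space P by (rule prob_space_P)
  have "finite_measure (distr P T (\<lambda>z. (x, z)))"
    using P.prob_space_distr[OF pair] prob_space.finite_measure by blast
  then have G: "(\<lambda>(x, z). G x z) \<in> measurable (completion (distr P T (\<lambda>z. (x, z)))) (borel_on (Rn d))"
    using G_universally_measurable by (simp add: universally_measurable_def T_def)
  have "(\<lambda>z. (x, z)) \<in> measurable (completion P) (completion (distr P T (\<lambda>z. (x, z))))"
    using distr_completion_complete(1)[OF completion.complete_measure_axioms measurable_completion[OF pair]]
    unfolding distr_completion[OF pair] .
  from measurable_compose[OF this G] have "(\<lambda>z. G x z) \<in> measurable (completion P) (borel_on (Rn d))" by simp
  then show ?thesis by (rule borel_on_component_compose)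
qed

text \<open>Means and variances are integrals against the completed law \<open>P\<close>, which
  \<open>\<xi>\<close> and \<open>cxi\<close> share.\<close>

lemma bounded_variance_CM: "bounded_variance CM d cxi X G p \<sigma>"
  unfolding bounded_variance_def
proof (intro ballI conjI allI impI)
  fix x assume x: "x \<in> X"
  note Gm = G_section_measurable[OF x]
  note M = integrable_complete_iff[OF complete_measure_axioms \<xi>_rv Gm]
  note C = integrable_complete_iff[OF complete_CM cxi(1), unfolded cxi(2), OF Gm]
  show "integrable CM (\<lambda>s. G x (cxi s) i)" if "i < d" for i
    using variance x that M(1)[of i] C(1)[of i] by (auto simp: bounded_variance_def)
  have mean: "(\<integral>s. G x (cxi s) i \<partial>CM) = (\<integral>\<omega>. G x (\<xi> \<omega>) i \<partial>M)" for i
    using M(2)[of i] C(2)[of i] by simp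
  define u where "u = (\<lambda>z. ennreal ((pnorm d p (vdiff (G x z) (\<lambda>i. \<integral>\<omega>. G x (\<xi> \<omega>) i \<partial>M)))\<^sup>2))"
  have u: "u \<in> borel_measurable (completion P)"
    unfolding u_def using Gm by (intro measurable_compose[OF _ measurable_ennreal] borel_measurable_power
        borel_measurable_pnorm borel_measurable_vdiff) auto
  have "(\<integral>\<^sup>+s. u (cxi s) \<partial>CM) = (\<integral>\<^sup>+\<omega>. u (\<xi> \<omega>) \<partial>M)"
    using nn_integral_complete[OF complete_CM cxi(1), unfolded cxi(2), OF u]
      nn_integral_complete[OF complete_measure_axioms \<xi>_rv u] by simp
  then show "(\<integral>\<^sup>+s. ennreal ((pnorm d p (vdiff (G x (cxi s)) (\<lambda>i. \<integral>s. G x (cxi s) i \<partial>CM)))\<^sup>2) \<partial>CM) \<le> ennreal (\<sigma>\<^sup>2)"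
    using variance x unfolding mean by (simp add: bounded_variance_def u_def)
qed

lemma stochastic_program_CM: "stochastic_program CM d m \<Xi> cxi B X f G"
proof -
  have "prob_space CM" by (rule prob_space.prob_space_completion[OF prob_space_SP])
  moreover have "stochastic_program_axioms CM d m \<Xi> cxi B X f G"
  proof
    show "integrable CM (\<lambda>s. f x (cxi s))" if "x \<in> X" for x
      using cxi_integral(1)[of x] f_integrable that X_subset by blast
    show "AE z in distr CM (borel_on \<Xi>) cxi. G x z \<in> subdifferential d B (\<lambda>y. f y z) x" if "x \<in> X" for x
      using G_subgradient[OF that] unfolding cxi(2) .
  qed (fact dims \<Xi>_borel cxi(1) B_open B_convex X_subset X_nonempty X_closed X_convex f_measurable
      G_universally_measurable)+
  ultimately show ?thesis using complete_CM by (simp add: stochastic_program_def)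
qed

lemma iid_sample_CM: "iid_sample CM \<Xi> cxi N cxis"
proof -
  interpret CM: prob_space CM by (rule prob_space.prob_space_completion[OF prob_space_SP])
  have id: "(\<lambda>s. \<lambda>j\<in>{1..N}. s j) \<in> measurable SP (\<Pi>\<^sub>M j\<in>{1..N}. borel_on \<Xi>)"
    unfolding SP_def by (intro measurable_restrict) (auto intro: measurable_component_singleton)
  \<comment> \<open>Points of \<open>SP\<close> are extensional, so restriction to
    \<open>{1..N}\<close> is the identity on them.\<close>
  have "distr CM (\<Pi>\<^sub>M j\<in>{1..N}. borel_on \<Xi>) (\<lambda>s. \<lambda>j\<in>{1..N}. cxis j s) = distr SP SP (\<lambda>s. s)"
    unfolding distr_completion[OF id] 
    by (intro distr_cong refl sets_SP[symmetric]) (auto simp: SP_def space_PiM)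
  also have "\<dots> = SP" by simp
  also have "SP = (\<Pi>\<^sub>M j\<in>{1..N}. distr CM (borel_on \<Xi>) (cxis j))"
    by (subst SP_def, intro PiM_cong refl coordinate(2)[symmetric])
  finally have "CM.indep_vars (\<lambda>_. borel_on \<Xi>) cxis {1..N}"
    using N_ge coordinate(1) by (subst CM.indep_vars_iff_distr_eq_PiM') auto
  then show ?thesis
    using coordinate(2) cxi(2) by (auto simp: iid_sample_def)
qed

text \<open>The sample space becomes the outcome space, which has the reference type, while
  \<open>f\<close>, \<open>G\<close> and the solution map \<open>xt\<close> stay the same.\<close>

lemma saa_problem_CM:
  "saa_problem CM d m \<Xi> cxi B X f G xs x0 N cxis q q' \<epsilon> R lam L K p \<sigma> \<delta> xt"
proof -
  have "composite_structure d (objective_dom CM cxi f B) X (objective CM cxi f) q L K"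
    unfolding objective_dom_CM
    by (rule composite_structure_cong[OF _ composite]) (use cxi_integral(2) X_subset in \<open>auto simp: objective_dom_def\<close>)
  moreover have "\<forall>x\<in>X. objective CM cxi f xs \<le> objective CM cxi f x"
    using xs_min xs_X cxi_integral(2) X_subset by (auto simp: subset_iff simp del: One_nat_def)
  ultimately show ?thesis
    unfolding saa_problem_def saa_problem_axioms_def cxi(2)
    using stochastic_program_CM xs_X x0_X N_ge iid_sample_CM q_gt \<epsilon>_pos \<epsilon>_le q' R_ge lam_eq L_ge K_ge p \<sigma>_ge
      bounded_variance_CM f_convex \<delta> approx_sol by blast
qed

end

lemma sample_size_guarantee_iff:
  "sample_size_guarantee TYPE('w) C \<longleftrightarrow>
    (\<forall>(M :: 'w measure) d m \<Xi> \<xi> B X f G xs x0 N \<xi>s q q' \<epsilon> R lam L K p \<sigma> \<delta> xt.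
      saa_problem M d m \<Xi> \<xi> B X f G xs x0 N \<xi>s q q' \<epsilon> R lam L K p \<sigma> \<delta> xt \<longrightarrow>
      (let gap = (\<lambda>\<omega>. objective M \<xi> f (xt (sample_vector N \<xi>s \<omega>)) - objective M \<xi> f xs)
       in (real N \<ge> C * R / (q' - 1) * max (L / \<epsilon>) ((\<sigma>\<^sup>2 + K\<^sup>2) / \<epsilon>\<^sup>2) \<longrightarrow>
             integrable M gap \<and> (\<integral>\<omega>. gap \<omega> \<partial>M) \<le> \<epsilon>) \<and>
          (\<forall>\<beta>. 0 < \<beta> \<and> \<beta> < 1 \<and>
             real N \<ge> C * R / (q' - 1) * max (L / \<epsilon>) ((\<sigma>\<^sup>2 + K\<^sup>2) / (\<beta> * \<epsilon>\<^sup>2)) \<longrightarrow>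
             \<P>(\<omega> in M. gap \<omega> \<le> \<epsilon>) \<ge> 1 - \<beta>)))"
  by (simp only: sample_size_guarantee_def saa_problem_def saa_problem_axioms_def conj_assoc)

lemma sample_size_guarantee_528: "sample_size_guarantee TYPE('w) 528"
  unfolding sample_size_guarantee_iff Let_def
proof (intro allI impI conjI)
  fix M :: "'w measure" and d m \<Xi> \<xi> B X f G xs x0 N \<xi>s and q q' \<epsilon> R lam L K p \<sigma> \<delta> :: real and xt
  assume "saa_problem M d m \<Xi> \<xi> B X f G xs x0 N \<xi>s q q' \<epsilon> R lam L K p \<sigma> \<delta> xt"
  then interpret saa_problem M d m \<Xi> \<xi> B X f G xs x0 N \<xi>s q q' \<epsilon> R lam L K p \<sigma> \<delta> xt .
  show "integrable M gap" "(\<integral>\<omega>. gap \<omega> \<partial>M) \<le> \<epsilon>"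
    if "real N \<ge> 528 * R / (q' - 1) * max (L / \<epsilon>) ((\<sigma>\<^sup>2 + K\<^sup>2) / \<epsilon>\<^sup>2)"
    using gap_bounds[of 1] that by auto
  show "\<P>(\<omega> in M. gap \<omega> \<le> \<epsilon>) \<ge> 1 - \<beta>"
    if "0 < \<beta> \<and> \<beta> < 1 \<and> real N \<ge> 528 * R / (q' - 1) * max (L / \<epsilon>) ((\<sigma>\<^sup>2 + K\<^sup>2) / (\<beta> * \<epsilon>\<^sup>2))" for \<beta>
    using gap_bounds(3)[of \<beta>] that by auto
qed

text \<open>In both models the gap is \<open>sample_gap\<close> composed with a map of law
  \<open>SP\<close>, so the two conclusions are the same assertion about \<open>SP\<close>.\<close>

lemma sample_size_guarantee_transfer:
  assumes "sample_size_guarantee TYPE(reference_outcome) C"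
  shows "sample_size_guarantee TYPE('w) C"
  unfolding sample_size_guarantee_iff
proof (intro allI impI)
  fix M :: "'w measure" and d m \<Xi> \<xi> B X f G xs x0 N \<xi>s and q q' \<epsilon> R lam L K p \<sigma> \<delta> :: real and xt
  assume "saa_problem M d m \<Xi> \<xi> B X f G xs x0 N \<xi>s q q' \<epsilon> R lam L K p \<sigma> \<delta> xt"
  then interpret saa_problem M d m \<Xi> \<xi> B X f G xs x0 N \<xi>s q q' \<epsilon> R lam L K p \<sigma> \<delta> xt .
  interpret C: saa_problem CM d m \<Xi> cxi B X f G xs x0 N cxis q q' \<epsilon> R lam L K p \<sigma> \<delta> xt
    by (rule saa_problem_CM)
  have "C.SP = SP" using C.SP_def[unfolded cxi(2)] SP_def[symmetric] by (rule trans)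
  then have "C.sample_gap = sample_gap"
    by (simp only: C.sample_gap_def[abs_def] sample_gap_def[abs_def] cxi(2))
  note C_transfer = C.gap_transfer[unfolded \<open>C.SP = SP\<close> \<open>C.sample_gap = sample_gap\<close>]
  have "let gap = C.gap
       in (real N \<ge> C * R / (q' - 1) * max (L / \<epsilon>) ((\<sigma>\<^sup>2 + K\<^sup>2) / \<epsilon>\<^sup>2) \<longrightarrow>
             integrable CM gap \<and> (\<integral>\<omega>. gap \<omega> \<partial>CM) \<le> \<epsilon>) \<and>
          (\<forall>\<beta>. 0 < \<beta> \<and> \<beta> < 1 \<and>
             real N \<ge> C * R / (q' - 1) * max (L / \<epsilon>) ((\<sigma>\<^sup>2 + K\<^sup>2) / (\<beta> * \<epsilon>\<^sup>2)) \<longrightarrow>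
             \<P>(\<omega> in CM. gap \<omega> \<le> \<epsilon>) \<ge> 1 - \<beta>)"
    by (rule assms[unfolded sample_size_guarantee_iff, rule_format, OF saa_problem_CM])
  then show "let gap = gap
       in (real N \<ge> C * R / (q' - 1) * max (L / \<epsilon>) ((\<sigma>\<^sup>2 + K\<^sup>2) / \<epsilon>\<^sup>2) \<longrightarrow>
             integrable M gap \<and> (\<integral>\<omega>. gap \<omega> \<partial>M) \<le> \<epsilon>) \<and>
          (\<forall>\<beta>. 0 < \<beta> \<and> \<beta> < 1 \<and>
             real N \<ge> C * R / (q' - 1) * max (L / \<epsilon>) ((\<sigma>\<^sup>2 + K\<^sup>2) / (\<beta> * \<epsilon>\<^sup>2)) \<longrightarrow>
             \<P>(\<omega> in M. gap \<omega> \<le> \<epsilon>) \<ge> 1 - \<beta>)"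
    unfolding Let_def C_transfer gap_transfer .
qed

theorem theorem2:
  shows "(\<exists>C2>0. sample_size_guarantee TYPE(reference_outcome) C2) \<and>
         (\<forall>C2>0. sample_size_guarantee TYPE(reference_outcome) C2 \<longrightarrow>
                  sample_size_guarantee TYPE('w) C2)"
proof (intro conjI allI impI)
  show "\<exists>C2>0. sample_size_guarantee TYPE(reference_outcome) C2"
    using sample_size_guarantee_528 by (intro exI[of _ 528]) simp
qed (rule sample_size_guarantee_transfer)

end
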